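(* Let $m\ge1$, $1<p_i<\infty$ for $i=1,\dots,m$, and $\frac1p=\frac1{p_1}+\dots+\frac1{p_m}$. Let $v$ and $w_1,\dots,w_m$ be weights on $\mathbb{R}^n$, let $\sigma_i=w_i^{1-p_i'}$ and $\overrightarrow\sigma=(\sigma_1,\dots,\sigma_m)$. Then $$\|\mathcal{M}(\overrightarrow{f\sigma})\|_{L^p(v)}\lesssim[v,\overrightarrow\sigma]_{B_{\overrightarrow P}}^{1/p}\prod_{i=1}^m\|f_i\|_{L^{p_i}(\sigma_i)}\qquad\text{for all } f_i\in L^{p_i}(\sigma_i),\ i=1,\dots,m,$$ where $\overrightarrow{f\sigma}=(f_1\sigma_1,\dots,f_m\sigma_m)$.
   Context: A weight is a locally integrable function on $\mathbb{R}^n$ that is positive almost everywhere; the functions $\sigma_i=w_i^{1-p_i'}$ are also understood to be weights. Here $p_i'=p_i/(p_i-1)$, $\overrightarrow P=(p_1,\dots,p_m)$, $\sigma(E)=\int_E\sigma\,dx$, and $\|f\|_{L^q(\sigma)}=\big(\int_{\mathbb{R}^n}|f|^q\sigma\,dx\big)^{1/q}$. The multisublinear maximal function of $\overrightarrow g=(g_1,\dots,g_m)$ is $$\mathcal{M}(\overrightarrow g)(x)=\sup_{Q\ni x}\prod_{i=1}^m\frac{1}{|Q|}\int_Q|g_i(y_i)|\,dy_i,$$ the supremum being over all cubes $Q\subset\mathbb{R}^n$ containing $x$. The multilinear $B_{\overrightarrow P}$ constant is $$[v,\overrightarrow\sigma]_{B_{\overrightarrow P}}=\sup_Q\frac{v(Q)}{|Q|}\Big(\prod_{i=1}^m\frac{\sigma_i(Q)}{|Q|}\Big)^p\exp\Big(\frac1{|Q|}\int_Q\log\prod_{i=1}^m\sigma_i^{-\frac{p}{p_i}}\,dx\Big),$$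 the supremum being over all cubes $Q\subset\mathbb{R}^n$. $A\lesssim B$ means $A\le cB$ with a constant $c$ independent of the weights, of the weight constants and of the functions $f_i$ ($c$ may depend on $n$, $m$ and $\overrightarrow P$). *)

theory Defs
  imports "HOL-Analysis.Analysis"
begin

text \<open>Exponents are only ever positive here, so \<open>\<infinity>\<close> to any power is \<open>\<infinity>\<close> and
  \<open>0\<close> to any power is \<open>0\<close>.\<close>

definition epowr :: "ennreal \<Rightarrow> real \<Rightarrow> ennreal" where
  "epowr x r = (if x = \<infinity> then \<infinity> else ennreal (enn2real x powr r))"

definition weight :: "(real ^ 'n \<Rightarrow> real) \<Rightarrow> bool" where
  "weight w \<longleftrightarrow> (\<forall>K. compact K \<longrightarrow> w absolutely_integrable_on K) \<and> (AE x in lebesgue. 0 < w x)"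

text \<open>Cubes have sides parallel to the axes. They are taken closed; for locally integrable
  functions this does not affect the
  suprema below.\<close>

definition cubes :: "(real ^ 'n) set set" where
  "cubes = {cbox a (\<chi> i. a $ i + s) | a s. 0 < s}"

definition average :: "(real ^ 'n) set \<Rightarrow> (real ^ 'n \<Rightarrow> real) \<Rightarrow> real" where
  "average Q g = (LINT x:Q|lebesgue. g x) / measure lebesgue Q"

definition multi_maximal :: "nat \<Rightarrow> (nat \<Rightarrow> real ^ 'n \<Rightarrow> real) \<Rightarrow> real ^ 'n \<Rightarrow> ennreal" where
  "multi_maximal m g x =
     (SUP Q \<in> {Q \<in> cubes. x \<in> Q}.
        \<Prod>i\<in>{1..m}. (\<integral>\<^sup>+y\<in>Q. ennreal \<bar>g i y\<bar> \<partial>lebesgue) / emeasure lebesgue Q)"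

text \<open>The functions measured are \<open>[0,\<infinity>]\<close>-valued because the maximal function is; a
  real-valued \<open>f\<close> enters through \<open>\<bar>f\<bar>\<close>. For a weight \<open>\<sigma>\<close> the truncation of negative values
  in \<open>ennreal (\<sigma> x)\<close> only concerns a null set.\<close>

definition weighted_norm :: "real \<Rightarrow> (real ^ 'n \<Rightarrow> real) \<Rightarrow> (real ^ 'n \<Rightarrow> ennreal) \<Rightarrow> ennreal" where
  "weighted_norm q \<sigma> F = epowr (\<integral>\<^sup>+x. epowr (F x) q * ennreal (\<sigma> x) \<partial>lebesgue) (1 / q)"

definition weighted_Lp :: "real \<Rightarrow> (real ^ 'n \<Rightarrow> real) \<Rightarrow> (real ^ 'n \<Rightarrow> real) set" where
  "weighted_Lp q \<sigma> =
     {f \<in> borel_measurable lebesgue. weighted_norm q \<sigma> (\<lambda>x. ennreal \<bar>f x\<bar>) < \<infinity>}"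

definition conj_exponent :: "real \<Rightarrow> real" where
  "conj_exponent q = q / (q - 1)"

definition dual_weight :: "real \<Rightarrow> (real ^ 'n \<Rightarrow> real) \<Rightarrow> real ^ 'n \<Rightarrow> real" where
  "dual_weight q w = (\<lambda>x. w x powr (1 - conj_exponent q))"

text \<open>The real-valued integrals carry no junk values in the intended use: if
  \<open>\<sigma> i = dual_weight (P i) (w i)\<close> and both \<open>w i\<close> and \<open>\<sigma> i\<close> are weights, then
  \<open>ln (\<sigma> i) \<le> \<sigma> i\<close> and \<open>- (P i - 1) * ln (\<sigma> i) = ln (w i) \<le> w i\<close> almost everywhere, so the
  logarithm below is integrable over every cube. The supremum is taken in \<open>[0,\<infinity>]\<close>, so the
  constant may be infinite.\<close>

definition B_constant ::
    "nat \<Rightarrow> (nat \<Rightarrow> real) \<Rightarrow> real \<Rightarrow> (real ^ 'n \<Rightarrow> real) \<Rightarrow> (nat \<Rightarrow> real ^ 'n \<Rightarrow> real) \<Rightarrow> ennreal" where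
  "B_constant m P p v \<sigma> =
     (SUP Q \<in> cubes. ennreal
        (average Q v * (\<Prod>i\<in>{1..m}. average Q (\<sigma> i)) powr p
          * exp (average Q (\<lambda>x. ln (\<Prod>i\<in>{1..m}. \<sigma> i x powr (- (p / P i)))))))"

end

theory Submission
  imports Defs
begin

text \<open>
  Suppose first that the cubes run over one dyadic grid. Up to a constant, a stopping time argument replaces the
  supremum \<open>\<M>(f\<sigma>)\<^sup>p\<close> by the sum of \<open>(\<Prod>\<^sub>i |Q|\<^sup>-\<^sup>1 \<integral>\<^sub>Q f\<^sub>i \<sigma>\<^sub>i)\<^sup>p\<close> over a sparse family of cubes \<open>Q\<close>, that is, one in
  which each \<open>Q\<close> keeps half of its measure outside the smaller cubes of the family
  (\<open>sparse_domination\<close>). Write the mean of \<open>f\<^sub>i \<sigma>\<^sub>i\<close> as the mean of \<open>\<sigma>\<^sub>i\<close> times the mean \<open>A\<^sub>i\<close> of \<open>f\<^sub>i\<close> with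
  respect to \<open>\<sigma>\<^sub>i dx\<close>. After integration against \<open>v\<close>, the constant \<open>[v, \<sigma>]\<close> turns
  \<open>v(Q) (\<Prod>\<^sub>i \<sigma>\<^sub>i(Q) / |Q|)\<^sup>p\<close> into \<open>|Q|\<close> times a product of powers \<open>p / p\<^sub>i\<close> of the geometric means
  \<open>G\<^sub>i\<close> of the \<open>\<sigma>\<^sub>i\<close>. As these exponents have sum one, Hoelder's inequality for sums leaves, for each \<open>i\<close>, the sum
  of \<open>|Q| A\<^sub>i\<^bsup>p\<^sub>i\<^esup> G\<^sub>i\<close> to be bounded by a multiple of \<open>\<integral> f\<^sub>i\<^bsup>p\<^sub>i\<^esup> \<sigma>\<^sub>i\<close>.

  By Jensen's inequality \<open>G\<^sub>i\<close> is at most the square of the mean of \<open>\<surd>\<sigma>\<^sub>i\<close>. This square root is the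
  gain of a geometric over an arithmetic mean: it lets the maximal operator act on \<open>L\<^sup>2\<close>,
  where it is bounded, instead of \<open>L\<^sup>1\<close>. Since \<open>A\<^sub>i\<close> is at most the maximal function \<open>M\<^sub>\<sigma> f\<^sub>i\<close> with respect to
  \<open>\<sigma>\<^sub>i dx\<close> everywhere on \<open>Q\<close>, the term of \<open>Q\<close> is at most \<open>|Q|\<close> times the squared mean of \<open>h = (M\<^sub>\<sigma> f\<^sub>i)\<^bsup>p\<^sub>i/2\<^esup> \<surd>\<sigma>\<^sub>i\<close>. By
  sparseness and Doob's inequality on \<open>L\<^sup>2(dx)\<close> the sum is at most a multiple of
  \<open>\<integral> h\<^sup>2 = \<integral> (M\<^sub>\<sigma> f\<^sub>i)\<^bsup>p\<^sub>i\<^esup> \<sigma>\<^sub>i\<close>, and Doob's inequality on \<open>L\<^bsup>p\<^sub>i\<^esup>(\<sigma>\<^sub>i dx)\<close> finishes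
  the estimate (\<open>sparse_sum_sqrt_weight\<close>).

  All this uses of the grid only that any two of its members are nested or disjoint, and is carried out
  for such families of sets in an arbitrary measure space. The passage to all
  cubes is the one-third trick: each cube of side less than a sixth of \<open>2\<^sup>N\<close> lies in a cell of comparable size of one of \<open>2\<^sup>n\<close>
  translates of the standard grid. The translates depend on \<open>N\<close>, and Fatou's lemma
  lets \<open>N\<close> tend to infinity.\<close>

section \<open>Powers with values in the extended half-line\<close>

lemma epowr_ennreal: "0 \<le> x \<Longrightarrow> epowr (ennreal x) r = ennreal (x powr r)"
  by (simp add: epowr_def)

lemma epowr_top [simp]: "epowr top r = top"
  by (simp add: epowr_def)

lemma epowr_zero [simp]: "epowr 0 r = 0"
  by (simp add: epowr_def)

lemma epowr_one [simp]: "epowr x 1 = x"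
  by (cases x) (auto simp: epowr_ennreal)

lemma epowr_eq_0_iff [simp]: "epowr x r = 0 \<longleftrightarrow> x = 0"
  by (cases x) (auto simp: epowr_ennreal)

lemma epowr_mono: "x \<le> y \<Longrightarrow> 0 \<le> r \<Longrightarrow> epowr x r \<le> epowr y r"
  by (cases x; cases y) (auto simp: epowr_ennreal powr_mono2 top_unique)

lemma epowr_epowr: "epowr (epowr x a) b = epowr x (a * b)"
  by (cases x) (auto simp: epowr_ennreal powr_powr)

lemma epowr_mult: "epowr (x * y) r = epowr x r * epowr y r"
proof (cases "x = top \<or> y = top")
  case True
  then show ?thesis
    by (cases "x = 0"; cases "y = 0") (auto simp: ennreal_mult_top ennreal_top_mult)
next
  case False
  then show ?thesis
    by (cases x; cases y) (auto simp: epowr_ennreal powr_mult simp flip: ennreal_mult)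
qed

lemma epowr_one_base [simp]: "epowr 1 r = 1"
  using epowr_ennreal[of 1 r] by simp

lemma epowr_prod: "finite I \<Longrightarrow> epowr (\<Prod>i\<in>I. f i) r = (\<Prod>i\<in>I. epowr (f i) r)"
  by (induction I rule: finite_induct) (auto simp: epowr_mult)

lemma epowr_add: "epowr x (a + b) = epowr x a * epowr x b"
  by (cases x) (auto simp: epowr_ennreal powr_add ennreal_mult)

lemma epowr_sum:
  assumes "finite I" "I \<noteq> {}"
  shows "epowr x (\<Sum>i\<in>I. \<theta> i) = (\<Prod>i\<in>I. epowr x (\<theta> i))"
  using assms by (induction I rule: finite_ne_induct) (auto simp: epowr_add)

lemma epowr_le_iff:
  assumes "0 < r"
  shows "epowr x r \<le> c \<longleftrightarrow> x \<le> epowr c (1 / r)"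
proof
  assume "epowr x r \<le> c"
  from epowr_mono[OF this, of "1 / r"] show "x \<le> epowr c (1 / r)"
    using assms by (simp add: epowr_epowr)
next
  assume "x \<le> epowr c (1 / r)"
  from epowr_mono[OF this, of r] show "epowr x r \<le> c"
    using assms by (simp add: epowr_epowr)
qed

lemma borel_measurable_epowr [measurable]:
  assumes [measurable]: "f \<in> borel_measurable M"
  shows "(\<lambda>x. epowr (f x) r) \<in> borel_measurable M"
proof -
  have [measurable]: "{x \<in> space M. f x = \<infinity>} \<in> sets M" by measurable
  show ?thesis unfolding epowr_def by measurable
qed

lemma weighted_arith_geom_mean:
  fixes x \<theta> :: "'i \<Rightarrow> real"
  assumes "finite I" "\<And>i. i \<in> I \<Longrightarrow> 0 < \<theta> i" "(\<Sum>i\<in>I. \<theta> i) = 1" "\<And>i. i \<in> I \<Longrightarrow> 0 \<le> x i"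
  shows "(\<Prod>i\<in>I. x i powr \<theta> i) \<le> (\<Sum>i\<in>I. \<theta> i * x i)"
proof (cases "\<exists>i\<in>I. x i = 0")
  case True
  then have "(\<Prod>i\<in>I. x i powr \<theta> i) = 0"
    using assms(1) by auto
  moreover have "0 \<le> (\<Sum>i\<in>I. \<theta> i * x i)"
    by (intro sum_nonneg mult_nonneg_nonneg less_imp_le[OF assms(2)] assms(4))
  ultimately show ?thesis by simp
next
  case False
  with assms have pos: "0 < x i" if "i \<in> I" for i
    using that by (metis less_eq_real_def)
  have ne: "I \<noteq> {}"
    using assms(3) by auto
  have "(\<Sum>i\<in>I. \<theta> i * ln (x i)) \<le> ln (\<Sum>i\<in>I. \<theta> i *\<^sub>R x i)"
    by (rule concave_on_sum[OF assms(1) ne ln_concave assms(3)])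
      (use assms(2) pos in \<open>auto intro: less_imp_le\<close>)
  moreover have "0 < (\<Sum>i\<in>I. \<theta> i *\<^sub>R x i)"
    using assms(1,2) ne pos by (auto intro!: sum_pos)
  ultimately have "exp (\<Sum>i\<in>I. \<theta> i * ln (x i)) \<le> (\<Sum>i\<in>I. \<theta> i * x i)"
    by (simp add: ln_ge_iff)
  moreover have "exp (\<Sum>i\<in>I. \<theta> i * ln (x i)) = (\<Prod>i\<in>I. x i powr \<theta> i)"
    using assms(1) pos by (simp add: exp_sum powr_def less_imp_neq[symmetric] cong: prod.cong) 
  ultimately show ?thesis by simp
qed

text \<open>After normalising each factor to have sum one, this is the arithmetic-geometric
  mean inequality, summed.\<close>

lemma Hoelder_inequality_sum:
  fixes X :: "'i \<Rightarrow> 'q \<Rightarrow> ennreal"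
  assumes "finite I" "finite S" "\<And>i. i \<in> I \<Longrightarrow> 0 < \<theta> i" "(\<Sum>i\<in>I. \<theta> i) = 1"
  shows "(\<Sum>Q\<in>S. \<Prod>i\<in>I. epowr (X i Q) (\<theta> i)) \<le> (\<Prod>i\<in>I. epowr (\<Sum>Q\<in>S. X i Q) (\<theta> i))"
proof -
  have ne: "I \<noteq> {}"
    using assms(4) by auto
  consider "\<exists>i\<in>I. (\<Sum>Q\<in>S. X i Q) = 0" | "\<forall>i\<in>I. (\<Sum>Q\<in>S. X i Q) \<noteq> 0" "\<exists>i\<in>I. (\<Sum>Q\<in>S. X i Q) = top"
    | "\<forall>i\<in>I. (\<Sum>Q\<in>S. X i Q) \<noteq> 0 \<and> (\<Sum>Q\<in>S. X i Q) \<noteq> top" by blast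
  then show ?thesis
  proof cases
    case 1
    then obtain j where j: "j \<in> I" "\<And>Q. Q \<in> S \<Longrightarrow> X j Q = 0"
      using assms(2) by auto
    then have "(\<Prod>i\<in>I. epowr (X i Q) (\<theta> i)) = 0" if "Q \<in> S" for Q
      using that assms(1) by auto
    then have "(\<Sum>Q\<in>S. \<Prod>i\<in>I. epowr (X i Q) (\<theta> i)) = 0" by (intro sum.neutral) blast
    then show ?thesis by (metis zero_le)
  next
    case 2
    then obtain j where j: "j \<in> I" "(\<Sum>Q\<in>S. X j Q) = top" by blast
    have "(\<Prod>i\<in>I. epowr (\<Sum>Q\<in>S. X i Q) (\<theta> i))
        = epowr (\<Sum>Q\<in>S. X j Q) (\<theta> j) * (\<Prod>i\<in>I - {j}. epowr (\<Sum>Q\<in>S. X i Q) (\<theta> i))"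
      using j(1) assms(1) by (simp add: prod.remove)
    also have "\<dots> = top"
      using 2(1) assms(1) unfolding j(2) epowr_top
      by (intro ennreal_top_mult_right) auto
    finally show ?thesis by simp
  next
    case 3
    define A where "A i = enn2real (\<Sum>Q\<in>S. X i Q)" for i
    define x where "x i Q = enn2real (X i Q)" for i Q
    have A: "(\<Sum>Q\<in>S. X i Q) = ennreal (A i)" "0 < A i" if "i \<in> I" for i
      using 3 that unfolding A_def
      by (auto simp: ennreal_enn2real_if enn2real_positive_iff less_top[symmetric] zero_less_iff_neq_zero
          simp del: sum_eq_0_iff ennreal_sum_less_top)
    have x0: "0 \<le> x i Q" for i Q by (simp add: x_def)
    have X: "X i Q = ennreal (x i Q)" if "i \<in> I" "Q \<in> S" for i Q
    proof -
      have "X i Q \<le> (\<Sum>Q\<in>S. X i Q)"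
        using assms(2) that(2) by (intro member_le_sum) auto
      then show ?thesis
        using 3 that(1) by (auto simp: x_def ennreal_enn2real_if top_unique simp del: sum_eq_0_iff)
    qed
    have sumx: "(\<Sum>Q\<in>S. x i Q) = A i" if "i \<in> I" for i
      using A[OF that] X[OF that] x0
      by (metis (no_types, lifting) ennreal_inj less_imp_le sum.cong sum_ennreal sum_nonneg)
    have "(\<Sum>Q\<in>S. \<Prod>i\<in>I. x i Q powr \<theta> i) = (\<Prod>i\<in>I. A i powr \<theta> i) * (\<Sum>Q\<in>S. \<Prod>i\<in>I. (x i Q / A i) powr \<theta> i)"
      unfolding sum_distrib_left prod.distrib[symmetric]
    proof (intro sum.cong prod.cong refl)
      fix Q i assume "i \<in> I"
      with A(2)[of i] show "x i Q powr \<theta> i = A i powr \<theta> i * (x i Q / A i) powr \<theta> i"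
        using x0[of i Q] by (simp add: powr_divide)
    qed
    also have "\<dots> \<le> (\<Prod>i\<in>I. A i powr \<theta> i) * (\<Sum>Q\<in>S. \<Sum>i\<in>I. \<theta> i * (x i Q / A i))"
      using assms(1,3,4) A(2) x0
      by (intro mult_left_mono sum_mono weighted_arith_geom_mean prod_nonneg)
        (auto intro!: divide_nonneg_pos)
    also have "(\<Sum>Q\<in>S. \<Sum>i\<in>I. \<theta> i * (x i Q / A i)) = (\<Sum>i\<in>I. \<theta> i)"
    proof (subst sum.swap, intro sum.cong refl)
      fix i assume "i \<in> I"
      then show "(\<Sum>Q\<in>S. \<theta> i * (x i Q / A i)) = \<theta> i"
        using sumx[of i] A(2)[of i] by (simp flip: sum_distrib_left sum_divide_distrib)
    qed
    finally have "(\<Sum>Q\<in>S. \<Prod>i\<in>I. x i Q powr \<theta> i) \<le> (\<Prod>i\<in>I. A i powr \<theta> i)"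
      using assms(4) by simp
    moreover have "(\<Sum>Q\<in>S. \<Prod>i\<in>I. epowr (X i Q) (\<theta> i)) = ennreal (\<Sum>Q\<in>S. \<Prod>i\<in>I. x i Q powr \<theta> i)"
      by (subst sum_ennreal[symmetric]) (auto simp: X epowr_ennreal x0 prod_ennreal prod_nonneg cong: sum.cong prod.cong)
    moreover have "(\<Prod>i\<in>I. epowr (\<Sum>Q\<in>S. X i Q) (\<theta> i)) = ennreal (\<Prod>i\<in>I. A i powr \<theta> i)"
      using A by (subst prod_ennreal[symmetric]) (auto simp: epowr_ennreal less_imp_le cong: prod.cong)
    ultimately show ?thesis by (simp add: ennreal_leI)
  qed
qed

section \<open>Maximal functions over laminar families of sets\<close>

definition laminar :: "'a set set \<Rightarrow> bool" where
  "laminar F \<longleftrightarrow> (\<forall>A\<in>F. \<forall>B\<in>F. A \<inter> B = {} \<or> A \<subseteq> B \<or> B \<subseteq> A)"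

text \<open>Integral means of functions with values in \<open>[0,\<infinity>]\<close>, with respect to any measure: besides Lebesgue
  measure they are taken with respect to the measures \<open>\<sigma> dx\<close>.\<close>

definition mean :: "'a measure \<Rightarrow> 'a set \<Rightarrow> ('a \<Rightarrow> ennreal) \<Rightarrow> ennreal" where
  "mean M Q f = (\<integral>\<^sup>+x\<in>Q. f x \<partial>M) / emeasure M Q"

definition family_maximal :: "'a measure \<Rightarrow> 'a set set \<Rightarrow> ('a \<Rightarrow> ennreal) \<Rightarrow> 'a \<Rightarrow> ennreal" where
  "family_maximal M F f x = (SUP Q\<in>F. mean M Q f * indicator Q x)"

lemma laminar_subset: "laminar F \<Longrightarrow> G \<subseteq> F \<Longrightarrow> laminar G"
  unfolding laminar_def by blast

lemma mean_times_emeasure: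
  assumes "emeasure M Q \<noteq> 0" "emeasure M Q \<noteq> top"
  shows "mean M Q f * emeasure M Q = (\<integral>\<^sup>+x\<in>Q. f x \<partial>M)"
  using assms unfolding mean_def by (simp add: ennreal_divide_times less_top ennreal_times_divide mult_divide_eq_ennreal)

lemma mean_mono:
  "(\<And>x. x \<in> Q \<Longrightarrow> f x \<le> g x) \<Longrightarrow> mean M Q f \<le> mean M Q g"
  unfolding mean_def
  by (intro divide_right_mono_ennreal nn_integral_mono) (auto split: split_indicator)

lemma mean_cmult:
  assumes "f \<in> borel_measurable M" "Q \<in> sets M"
  shows "mean M Q (\<lambda>x. c * f x) = c * mean M Q f"
  using assms unfolding mean_def by (simp add: nn_integral_cmult mult.assoc ennreal_times_divide)

lemma mean_less_imp:
  assumes "c < mean M Q f"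
  shows "c * emeasure M Q \<le> (\<integral>\<^sup>+x\<in>Q. f x \<partial>M)"
proof (cases "emeasure M Q = 0 \<or> emeasure M Q = top")
  case True
  then show ?thesis using assms by (auto simp: mean_def)
next
  case False
  then show ?thesis
    using mean_times_emeasure[of M Q f] mult_right_mono[OF less_imp_le[OF assms], of "emeasure M Q"]
    by auto
qed

lemma borel_measurable_family_maximal [measurable]:
  assumes "countable F" "F \<subseteq> sets M"
  shows "family_maximal M F f \<in> borel_measurable M"
  unfolding family_maximal_def[abs_def]
  using assms by (intro borel_measurable_SUP) auto

lemma mean_le_family_maximal:
  "Q \<in> F \<Longrightarrow> x \<in> Q \<Longrightarrow> mean M Q f \<le> family_maximal M F f x"
  unfolding family_maximal_def by (rule SUP_upper2[of Q]) auto

lemma less_family_maximal_iff: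
  "c < family_maximal M F f x \<longleftrightarrow> (\<exists>Q\<in>F. x \<in> Q \<and> c < mean M Q f)"
  unfolding family_maximal_def less_SUP_iff
  by (auto split: split_indicator)

text \<open>The maximal members of the family are disjoint and have the same union, so the
  estimates on them add up.\<close>

lemma laminar_weak_type:
  assumes F: "finite F" "laminar F" "F \<subseteq> sets M" and f: "f \<in> borel_measurable M"
    and le: "\<And>Q. Q \<in> F \<Longrightarrow> c * emeasure M Q \<le> (\<integral>\<^sup>+x\<in>Q. f x \<partial>M)"
  shows "c * emeasure M (\<Union>F) \<le> (\<integral>\<^sup>+x\<in>\<Union>F. f x \<partial>M)"
proof -
  define G where "G = {Q\<in>F. \<forall>R\<in>F. Q \<subseteq> R \<longrightarrow> Q = R}"
  have G_max: "Q = R" if "Q \<in> G" "R \<in> G" "Q \<subseteq> R" for Q R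
    using that unfolding G_def mem_Collect_eq by metis
  have G: "finite G" "G \<subseteq> F" "G \<subseteq> sets M"
    using F by (auto simp: G_def)
  have "\<exists>R\<in>G. Q \<subseteq> R" if Q: "Q \<in> F" for Q
  proof -
    obtain R where R: "R \<in> F" "Q \<subseteq> R" "\<forall>S\<in>F. R \<subseteq> S \<longrightarrow> R = S"
      using finite_has_maximal2[OF F(1) Q] by metis
    from R(1,3) have "R \<in> G" unfolding G_def mem_Collect_eq by metis
    with R(2) show ?thesis by blast
  qed
  then have "\<Union>F \<subseteq> \<Union>G"
    by (meson Union_least Union_upper order.trans)
  with G(2) have U: "\<Union>F = \<Union>G"
    by (simp add: Union_mono subset_antisym)
  have disj: "disjoint_family_on (\<lambda>Q. Q) G"
    unfolding disjoint_family_on_def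
  proof (intro ballI impI)
    fix A B assume AB: "A \<in> G" "B \<in> G" "A \<noteq> B"
    with F(2) G(2) have "A \<inter> B = {} \<or> A \<subseteq> B \<or> B \<subseteq> A"
      unfolding laminar_def by blast
    with AB show "A \<inter> B = {}" using G_max by metis
  qed
  have sum_eq: "(\<Sum>Q\<in>G. emeasure N Q) = emeasure N (\<Union>G)" if "sets N = sets M" for N
    using sum_emeasure[of "\<lambda>Q. Q" G N] disj G that by simp
  have "c * emeasure M (\<Union>F) = (\<Sum>Q\<in>G. c * emeasure M Q)"
    by (simp only: U sum_eq[OF refl] flip: sum_distrib_left)
  also have "\<dots> \<le> (\<Sum>Q\<in>G. emeasure (density M f) Q)"
    using G le f by (intro sum_mono) (auto simp: emeasure_density subset_eq)
  also have "\<dots> = (\<integral>\<^sup>+x\<in>\<Union>F. f x \<partial>M)"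
    using sum_eq[of "density M f"] f sets.finite_Union[OF G(1,3)] by (simp add: U emeasure_density)
  finally show ?thesis .
qed

text \<open>Only the part of \<open>f\<close> above \<open>c\<close> matters: the part below contributes at most \<open>c\<close> to each mean.\<close>

lemma family_maximal_weak_type:
  assumes F: "finite F" "laminar F" "F \<subseteq> sets M" and f: "f \<in> borel_measurable M"
    and fin: "\<And>Q. Q \<in> F \<Longrightarrow> emeasure M Q < top" and c: "c < top"
  shows "c * emeasure M {x\<in>space M. 2 * c < family_maximal M F f x}
    \<le> (\<integral>\<^sup>+x. f x * indicator {x. c < f x} x \<partial>M)"
proof -
  note [measurable] = f
  define G where "G = {Q\<in>F. 2 * c < mean M Q f}"
  define h where "h x = f x * indicator {x. c < f x} x" for x
  have h [measurable]: "h \<in> borel_measurable M"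
    unfolding h_def by measurable
  have G: "finite G" "G \<subseteq> F" "laminar G" "G \<subseteq> sets M"
    using F by (auto simp: G_def intro: laminar_subset)
  have *: "c * emeasure M Q \<le> (\<integral>\<^sup>+x\<in>Q. h x \<partial>M)" if "Q \<in> G" for Q
  proof -
    have Q [measurable]: "Q \<in> sets M" using that G by auto
    have "2 * c * emeasure M Q \<le> (\<integral>\<^sup>+x\<in>Q. f x \<partial>M)"
      using that by (intro mean_less_imp) (simp add: G_def)
    also have "\<dots> \<le> (\<integral>\<^sup>+x. c * indicator Q x + h x * indicator Q x \<partial>M)"
      by (intro nn_integral_mono) (auto simp: h_def split: split_indicator)
    also have "\<dots> = c * emeasure M Q + (\<integral>\<^sup>+x\<in>Q. h x \<partial>M)"
      by (subst nn_integral_add) (auto simp: nn_integral_cmult)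
    finally have "c * emeasure M Q + c * emeasure M Q \<le> c * emeasure M Q + (\<integral>\<^sup>+x\<in>Q. h x \<partial>M)"
      by (simp add: mult_2 distrib_right)
    moreover have "c * emeasure M Q < top"
      using c fin that G by (auto simp: ennreal_mult_less_top)
    ultimately show ?thesis
      by (auto simp: ennreal_add_left_cancel_le less_top)
  qed
  have "{x\<in>space M. 2 * c < family_maximal M F f x} = \<Union>G"
    using G(4) sets.sets_into_space[of _ M] by (auto simp: less_family_maximal_iff G_def)
  then have "c * emeasure M {x\<in>space M. 2 * c < family_maximal M F f x} \<le> (\<integral>\<^sup>+x\<in>\<Union>G. h x \<partial>M)"
    using laminar_weak_type[OF G(1,3,4) h *] by simp
  also have "\<dots> \<le> (\<integral>\<^sup>+x. h x \<partial>M)"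
    by (intro nn_integral_mono) (auto split: split_indicator)
  finally show ?thesis unfolding h_def .
qed

text \<open>If \<open>2 * 2\<^sup>j < x \<le> 4 * 2\<^sup>j\<close>, then the term of \<open>j\<close> alone is at least \<open>x\<^sup>q\<close>. The heights are written as
  \<open>2 * 2\<^sup>j\<close> to match the two levels \<open>2 * c\<close> and \<open>c\<close> of the weak type estimate.\<close>

lemma epowr_le_dyadic_layers:
  assumes q: "0 < q"
  shows "epowr x q \<le> (\<integral>\<^sup>+j. ennreal (2 powr ((real_of_int j + 2) * q))
           * indicator {y. 2 * ennreal (2 powr j) < y} x \<partial>count_space UNIV)"
    (is "_ \<le> (\<integral>\<^sup>+j. ?g j \<partial>count_space UNIV)")
proof -
  have ge: "?g j \<le> (\<integral>\<^sup>+j. ?g j \<partial>count_space UNIV)" for j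
    by (rule nn_integral_ge_point) simp
  have two: "2 * ennreal (2 powr real_of_int j) = ennreal (2 powr (real_of_int j + 1))" for j
    by (subst ennreal_numeral[symmetric], subst ennreal_mult[symmetric]) (auto simp: powr_add)
  show ?thesis
  proof (cases x)
    case (real r)
    show ?thesis
    proof (cases "r = 0")
      case True
      then show ?thesis using real by simp
    next
      case False
      with real have r: "0 < r" by simp
      define j where "j = \<lceil>log 2 r\<rceil> - 2"
      have j: "real_of_int j + 1 < log 2 r" "log 2 r \<le> real_of_int j + 2"
        unfolding j_def by linarith+
      have "2 powr (real_of_int j + 1) < 2 powr (log 2 r)"
        using j by (intro powr_less_mono) auto
      then have lo: "2 powr (real_of_int j + 1) < r"
        using r by simp
      have "2 powr (log 2 r) \<le> 2 powr (real_of_int j + 2)"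
        using j by (intro powr_mono) auto
      then have "r \<le> 2 powr (real_of_int j + 2)"
        using r by simp
      then have "r powr q \<le> (2 powr (real_of_int j + 2)) powr q"
        using r q by (intro powr_mono2) auto
      then have "epowr x q \<le> ?g j"
        using lo real by (auto simp: epowr_ennreal two powr_powr ennreal_less_iff intro!: ennreal_leI)
      then show ?thesis using ge by (rule order_trans)
    qed
  next
    case top
    have "(\<integral>\<^sup>+j. ?g j \<partial>count_space UNIV) = top"
    proof (rule ccontr)
      assume "(\<integral>\<^sup>+j. ?g j \<partial>count_space UNIV) \<noteq> top"
      then obtain c where c: "0 \<le> c" "(\<integral>\<^sup>+j. ?g j \<partial>count_space UNIV) = ennreal c"
        by (cases "\<integral>\<^sup>+j. ?g j \<partial>count_space UNIV") auto
      define j where "j = \<lceil>log 2 (c + 1) / q\<rceil>"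
      have "log 2 (c + 1) / q \<le> real_of_int j + 2"
        unfolding j_def by linarith
      then have "log 2 (c + 1) \<le> (real_of_int j + 2) * q"
        using q by (simp add: pos_divide_le_eq)
      then have "2 powr (log 2 (c + 1)) \<le> 2 powr ((real_of_int j + 2) * q)"
        by (intro powr_mono) auto
      then have "c < 2 powr ((real_of_int j + 2) * q)"
        using c by simp
      moreover have "?g j = ennreal (2 powr ((real_of_int j + 2) * q))"
        using top by (simp add: two)
      ultimately show False
        using ge[of j] c by (simp add: ennreal_le_iff)
    qed
    then show ?thesis by simp
  qed
qed

definition doob_const :: "real \<Rightarrow> real" where
  "doob_const q = 2 powr (2 * q) / (1 - 2 powr (1 - q))"

lemma doob_const_pos: "1 < q \<Longrightarrow> 0 < doob_const q"
  using powr_less_mono[of "1 - q" 0 2] unfolding doob_const_def by (intro divide_pos_pos) auto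

text \<open>The sum is a geometric series in \<open>2\<^bsup>j (q - 1)\<^esup>\<close>, comparable to its largest term because \<open>q > 1\<close>;
  in that term \<open>2\<^sup>j\<close> is comparable to \<open>x\<close>.\<close>

lemma dyadic_layers_le_epowr:
  assumes q: "1 < q"
  shows "(\<integral>\<^sup>+j. ennreal (2 powr ((real_of_int j + 2) * q - j))
            * (x * indicator {y. ennreal (2 powr j) < y} x) \<partial>count_space UNIV)
         \<le> ennreal (doob_const q) * epowr x q"
    (is "(\<integral>\<^sup>+j. ?g j \<partial>count_space UNIV) \<le> _")
proof (cases x)
  case top
  then show ?thesis using doob_const_pos[OF q] by (simp add: ennreal_mult_top)
next
  case (real r)
  show ?thesis
  proof (cases "r = 0")
    case True
    then show ?thesis using real by simp
  next
    case False
    with real have r: "0 < r" by simp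
    define J where "J = \<lceil>log 2 r\<rceil> - 1"
    define \<rho> :: real where "\<rho> = 2 powr (1 - q)"
    have \<rho>: "0 < \<rho>" "\<rho> < 1"
      using powr_less_mono[of "1 - q" 0 2] q by (auto simp: \<rho>_def)
    have J: "real_of_int j \<le> J" if "2 powr real_of_int j < r" for j
    proof -
      have "real_of_int j < log 2 r"
        using that r by (simp add: less_log_iff)
      then have "j < \<lceil>log 2 r\<rceil>" by (simp add: less_ceiling_iff)
      then show ?thesis unfolding J_def by simp
    qed
    have "real_of_int J \<le> log 2 r" unfolding J_def by linarith
    then have Jr: "2 powr real_of_int J \<le> r"
      using r by (simp add: le_log_iff)
    have g: "?g j \<le> ennreal (2 powr ((real_of_int j + 2) * q - j) * r) * indicator {..J} j" for j
      using J[of j] real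
      by (auto simp: ennreal_mult' ennreal_less_iff split: split_indicator)
    have bij: "bij_betw (\<lambda>n. J - int n) UNIV {..J}"
      by (rule bij_betwI[where g = "\<lambda>j. nat (J - j)"]) auto
    have "(\<integral>\<^sup>+j. ?g j \<partial>count_space UNIV)
        \<le> (\<integral>\<^sup>+j. ennreal (2 powr ((real_of_int j + 2) * q - j) * r) * indicator {..J} j \<partial>count_space UNIV)"
      by (intro nn_integral_mono g)
    also have "\<dots> = (\<integral>\<^sup>+j. ennreal (2 powr ((real_of_int j + 2) * q - j) * r) \<partial>count_space {..J})"
      by (simp add: nn_integral_count_space_indicator)
    also have "\<dots> = (\<integral>\<^sup>+n. ennreal (2 powr ((real_of_int (J - int n) + 2) * q - real_of_int (J - int n)) * r) \<partial>count_space UNIV)"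
      by (rule nn_integral_bij_count_space[OF bij, symmetric])
    also have "\<dots> = (\<Sum>n. ennreal (2 powr (2 * q) * (2 powr J) powr (q - 1) * r * \<rho> ^ n))"
    proof (subst nn_integral_count_space_nat, intro arg_cong[where f = suminf] ext arg_cong[where f = ennreal])
      fix n
      have "(real_of_int (J - int n) + 2) * q - real_of_int (J - int n)
          = 2 * q + real_of_int J * (q - 1) + (1 - q) * real n"
        by (simp add: algebra_simps)
      moreover have "\<rho> ^ n = 2 powr ((1 - q) * real n)"
        using \<rho> by (simp add: \<rho>_def powr_powr flip: powr_realpow)
      ultimately show "2 powr ((real_of_int (J - int n) + 2) * q - real_of_int (J - int n)) * r
          = 2 powr (2 * q) * (2 powr J) powr (q - 1) * r * \<rho> ^ n"
        by (simp add: powr_add powr_powr)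
    qed
    also have "\<dots> = ennreal (2 powr (2 * q) * (2 powr J) powr (q - 1) * r * (1 / (1 - \<rho>)))"
      using \<rho> r by (intro suminf_ennreal_eq sums_mult geometric_sums) auto
    also have "\<dots> \<le> ennreal (2 powr (2 * q) * r powr (q - 1) * r * (1 / (1 - \<rho>)))"
      using Jr q r \<rho> by (intro ennreal_leI mult_right_mono mult_left_mono powr_mono2) auto
    also have "2 powr (2 * q) * r powr (q - 1) * r * (1 / (1 - \<rho>)) = doob_const q * r powr q"
      using r by (simp add: doob_const_def \<rho>_def powr_diff field_simps)
    also have "ennreal \<dots> = ennreal (doob_const q) * epowr x q"
      using real doob_const_pos[OF q] by (simp add: epowr_ennreal ennreal_mult)
    finally show ?thesis .
  qed
qed

text \<open>Doob's maximal inequality, for families in place of filtrations: the weak type estimate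
  integrated over the heights \<open>2\<^sup>j\<close>.\<close>

theorem Doob_maximal_inequality:
  assumes F: "finite F" "laminar F" "F \<subseteq> sets M" and f: "f \<in> borel_measurable M"
    and fin: "\<And>Q. Q \<in> F \<Longrightarrow> emeasure M Q < top" and q: "1 < q"
  shows "(\<integral>\<^sup>+x. epowr (family_maximal M F f x) q \<partial>M)
    \<le> ennreal (doob_const q) * (\<integral>\<^sup>+x. epowr (f x) q \<partial>M)"
proof -
  note [measurable] = f
  have [measurable]: "family_maximal M F f \<in> borel_measurable M"
    using F by (intro borel_measurable_family_maximal countable_finite)
  define a :: "int \<Rightarrow> ennreal" where "a j = ennreal (2 powr ((real_of_int j + 2) * q))" for j
  define b :: "int \<Rightarrow> ennreal" where "b j = ennreal (2 powr ((real_of_int j + 2) * q - j))" for j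
  define c :: "int \<Rightarrow> ennreal" where "c j = ennreal (2 powr j)" for j
  have abc: "a j = b j * c j" for j
    unfolding a_def b_def c_def by (subst ennreal_mult[symmetric]) (auto simp flip: powr_add)
  have "(\<integral>\<^sup>+x. epowr (family_maximal M F f x) q \<partial>M)
      \<le> (\<integral>\<^sup>+x. (\<integral>\<^sup>+j. a j * indicator {y. 2 * c j < y} (family_maximal M F f x) \<partial>count_space UNIV) \<partial>M)"
    unfolding a_def c_def using q by (intro nn_integral_mono epowr_le_dyadic_layers) auto
  also have "\<dots> = (\<integral>\<^sup>+j. (\<integral>\<^sup>+x. a j * indicator {y. 2 * c j < y} (family_maximal M F f x) \<partial>M) \<partial>count_space UNIV)"
    by (rule nn_integral_count_space_nn_integral) auto
  also have "\<dots> \<le> (\<integral>\<^sup>+j. (\<integral>\<^sup>+x. b j * (f x * indicator {y. c j < y} (f x)) \<partial>M) \<partial>count_space UNIV)"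
  proof (rule nn_integral_mono)
    fix j
    have "(\<integral>\<^sup>+x. a j * indicator {y. 2 * c j < y} (family_maximal M F f x) \<partial>M)
        = a j * (\<integral>\<^sup>+x. indicator {x\<in>space M. 2 * c j < family_maximal M F f x} x \<partial>M)"
      by (subst nn_integral_cmult[symmetric])
        (auto intro!: nn_integral_cong split: split_indicator)
    also have "\<dots> = b j * (c j * emeasure M {x\<in>space M. 2 * c j < family_maximal M F f x})"
      by (simp add: abc mult.assoc)
    also have "\<dots> \<le> b j * (\<integral>\<^sup>+x. f x * indicator {x. c j < f x} x \<partial>M)"
      using F f fin by (intro mult_left_mono family_maximal_weak_type) (auto simp: c_def)
    also have "\<dots> = (\<integral>\<^sup>+x. b j * (f x * indicator {y. c j < y} (f x)) \<partial>M)"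
      by (subst nn_integral_cmult[symmetric]) (auto intro!: nn_integral_cong split: split_indicator)
    finally show "(\<integral>\<^sup>+x. a j * indicator {y. 2 * c j < y} (family_maximal M F f x) \<partial>M)
      \<le> (\<integral>\<^sup>+x. b j * (f x * indicator {y. c j < y} (f x)) \<partial>M)" .
  qed
  also have "\<dots> = (\<integral>\<^sup>+x. (\<integral>\<^sup>+j. b j * (f x * indicator {y. c j < y} (f x)) \<partial>count_space UNIV) \<partial>M)"
    by (rule nn_integral_count_space_nn_integral[symmetric]) auto
  also have "\<dots> \<le> (\<integral>\<^sup>+x. ennreal (doob_const q) * epowr (f x) q \<partial>M)"
    unfolding b_def c_def using q by (intro nn_integral_mono dyadic_layers_le_epowr) auto
  also have "\<dots> = ennreal (doob_const q) * (\<integral>\<^sup>+x. epowr (f x) q \<partial>M)"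
    by (rule nn_integral_cmult) auto
  finally show ?thesis .
qed

section \<open>Sparse domination of products of means\<close>

definition remainder :: "'a set set \<Rightarrow> 'a set \<Rightarrow> 'a set" where
  "remainder S Q = Q - \<Union>{R\<in>S. R \<subset> Q}"

text \<open>Recursion along strict inclusion, from the largest sets down: a set is selected when its
  value exceeds \<open>a\<close> times that of every selected set containing it.\<close>

lemma stopping_family_exists:
  fixes \<phi> :: "'a set \<Rightarrow> ennreal"
  assumes "finite F"
  shows "\<exists>S\<subseteq>F. \<forall>Q\<in>F. Q \<in> S \<longleftrightarrow> (\<forall>R\<in>S. Q \<subset> R \<longrightarrow> a * \<phi> R < \<phi> Q)"
  using assms
proof (induction "card F" arbitrary: F)
  case 0
  then show ?case by auto
next
  case (Suc n)
  then have "F \<noteq> {}" by auto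
  with Suc.prems obtain Q0 where Q0: "Q0 \<in> F" "\<forall>R\<in>F. R \<subseteq> Q0 \<longrightarrow> Q0 = R"
    using finite_has_minimal[of F] by metis
  have "n = card (F - {Q0})" "finite (F - {Q0})"
    using Suc.hyps(2) Suc.prems Q0 by auto
  from Suc.hyps(1)[OF this] obtain S where S: "S \<subseteq> F - {Q0}"
    "\<And>Q. Q \<in> F - {Q0} \<Longrightarrow> Q \<in> S \<longleftrightarrow> (\<forall>R\<in>S. Q \<subset> R \<longrightarrow> a * \<phi> R < \<phi> Q)"
    by metis
  define T where "T = (if \<forall>R\<in>S. Q0 \<subset> R \<longrightarrow> a * \<phi> R < \<phi> Q0 then insert Q0 S else S)"
  have T: "T \<subseteq> F" "S \<subseteq> T" "T \<subseteq> insert Q0 S"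
    using S(1) Q0(1) by (auto simp: T_def)
  have "Q \<in> T \<longleftrightarrow> (\<forall>R\<in>T. Q \<subset> R \<longrightarrow> a * \<phi> R < \<phi> Q)" if Q: "Q \<in> F" for Q
  proof (cases "Q = Q0")
    case True
    then show ?thesis
      using S(1) by (auto simp: T_def)
  next
    case False
    then have "\<not> Q \<subset> Q0"
      using Q0(2) Q by (metis psubset_imp_subset)
    then have "(\<forall>R\<in>T. Q \<subset> R \<longrightarrow> a * \<phi> R < \<phi> Q) \<longleftrightarrow> (\<forall>R\<in>S. Q \<subset> R \<longrightarrow> a * \<phi> R < \<phi> Q)"
      using T by (metis insertE subsetD)
    moreover have "Q \<in> T \<longleftrightarrow> Q \<in> S"
      using False T by (metis insertE subsetD)
    ultimately show ?thesis
      using S(2)[of Q] Q False by simp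
  qed
  then show ?case using T(1) by metis
qed

text \<open>If the product of the means over \<open>R\<close> exceeds \<open>(2m)\<^sup>m\<close> times that over \<open>Q\<close>, then one of
  the \<open>m\<close> factors grew by more than \<open>2m\<close>. By the weak type estimate, the sets on which a
  given factor did so fill at most the fraction \<open>1/(2m)\<close> of \<open>Q\<close>.\<close>

lemma sparse_domination:
  fixes g :: "'i \<Rightarrow> 'a \<Rightarrow> ennreal"
  assumes F: "finite F" "laminar F" "F \<subseteq> sets M"
    and fin: "\<And>Q. Q \<in> F \<Longrightarrow> emeasure M Q \<noteq> 0" "\<And>Q. Q \<in> F \<Longrightarrow> emeasure M Q \<noteq> top"
    and I: "finite I" "I \<noteq> {}"
    and g: "\<And>i. i \<in> I \<Longrightarrow> g i \<in> borel_measurable M"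
  defines "\<phi> \<equiv> \<lambda>Q. \<Prod>i\<in>I. mean M Q (g i)"
  shows "\<exists>S\<subseteq>F. (\<forall>Q\<in>F. \<exists>R\<in>S. Q \<subseteq> R \<and> \<phi> Q \<le> of_nat ((2 * card I) ^ card I) * \<phi> R)
    \<and> (\<forall>Q\<in>S. emeasure M Q \<le> 2 * emeasure M (remainder S Q))"
proof -
  define m where "m = card I"
  define K :: ennreal where "K = of_nat (2 * m)"
  have m: "0 < m" using I by (simp add: m_def card_gt_0_iff)
  have K: "K \<noteq> 0" "K \<noteq> top"
    using m by (auto simp: K_def ennreal_of_nat_neq_top simp del: of_nat_mult)
  have a_ge: "1 \<le> K ^ m"
  proof -
    have "(1::nat) \<le> (2 * m) ^ m" using m by simp
    then have "(of_nat 1 :: ennreal) \<le> of_nat ((2 * m) ^ m)" by (rule of_nat_mono)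
    then show ?thesis by (simp add: K_def)
  qed
  obtain S where SF: "S \<subseteq> F"
    and S: "\<And>Q. Q \<in> F \<Longrightarrow> Q \<in> S \<longleftrightarrow> (\<forall>R\<in>S. Q \<subset> R \<longrightarrow> K ^ m * \<phi> R < \<phi> Q)"
    using stopping_family_exists[OF F(1), of "K ^ m" \<phi>] by metis
  have dom: "\<exists>R\<in>S. Q \<subseteq> R \<and> \<phi> Q \<le> K ^ m * \<phi> R" if "Q \<in> F" for Q
  proof (cases "Q \<in> S")
    case True
    have "1 * \<phi> Q \<le> K ^ m * \<phi> Q" by (intro mult_right_mono a_ge) simp
    with True show ?thesis by auto
  next
    case False
    then show ?thesis using S[OF that] by (auto simp: not_less)
  qed
  have sparse: "emeasure M Q \<le> 2 * emeasure M (remainder S Q)" if Q: "Q \<in> S" for Q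
  proof -
    define G where "G = {R\<in>S. R \<subset> Q}"
    define H where "H i = {R\<in>G. K * mean M Q (g i) < mean M R (g i)}" for i
    have QM: "Q \<in> sets M" and Qfin: "emeasure M Q \<noteq> 0" "emeasure M Q \<noteq> top"
      using Q SF F(3) fin by auto
    have G: "finite G" "G \<subseteq> F" "laminar G" "G \<subseteq> sets M"
      using SF F by (auto simp: G_def intro: laminar_subset finite_subset)
    have H: "finite (H i)" "H i \<subseteq> G" "laminar (H i)" "H i \<subseteq> sets M" for i
      using G by (auto simp: H_def intro: laminar_subset)
    have UH: "\<Union>(H i) \<in> sets M" for i
      using H by (intro sets.finite_Union) auto
    have UG: "\<Union>G \<in> sets M" "\<Union>G \<subseteq> Q"
      using G by (auto intro!: sets.finite_Union simp: G_def)
    have "\<exists>i\<in>I. R \<in> H i" if R: "R \<in> G" for R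
    proof (rule ccontr)
      assume "\<not> ?thesis"
      then have "mean M R (g i) \<le> K * mean M Q (g i)" if "i \<in> I" for i
        using that R by (auto simp: H_def not_less)
      then have "\<phi> R \<le> (\<Prod>i\<in>I. K * mean M Q (g i))"
        unfolding \<phi>_def by (intro prod_mono_ennreal)
      also have "\<dots> = K ^ m * \<phi> Q"
        by (simp add: \<phi>_def prod.distrib m_def)
      finally have "\<not> K ^ m * \<phi> Q < \<phi> R" by (simp add: not_less)
      moreover have "R \<in> F" "R \<in> S" "R \<subset> Q" using R G by (auto simp: G_def)
      ultimately show False using S[of R] Q by auto
    qed
    then have cover: "\<Union>G \<subseteq> (\<Union>i\<in>I. \<Union>(H i))" by blast
    have one: "K * emeasure M (\<Union>(H i)) \<le> emeasure M Q" if i: "i \<in> I" for i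
    proof (cases "H i = {}")
      case True
      then show ?thesis by simp
    next
      case False
      then obtain R where R: "R \<in> H i" by auto
      \<comment> \<open>The existence of \<open>R\<close> excludes the means \<open>0\<close> and \<open>\<infinity>\<close> over \<open>Q\<close>, by which one could not divide.\<close>
      define A where "A = mean M Q (g i)"
      have "R \<in> G" and less: "K * A < mean M R (g i)" using R by (auto simp: H_def A_def)
      from less have "K * A < top"
        by (rule less_le_trans) simp
      then have A_top: "A \<noteq> top" using K by (auto simp: ennreal_mult_top)
      have "0 < mean M R (g i)" using less by (metis gr_zeroI not_less_zero)
      then have "0 < (\<integral>\<^sup>+x\<in>R. g i x \<partial>M)" by (simp add: mean_def ennreal_zero_less_divide)
      also have "\<dots> \<le> (\<integral>\<^sup>+x\<in>Q. g i x \<partial>M)"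
        using \<open>R \<in> G\<close> by (intro nn_integral_mono) (auto simp: G_def split: split_indicator)
      finally have A0: "A \<noteq> 0"
        using Qfin by (simp add: A_def mean_def)
      have "(K * A) * emeasure M (\<Union>(H i)) \<le> (\<integral>\<^sup>+x\<in>\<Union>(H i). g i x \<partial>M)"
        using H[of i] g[OF i] by (intro laminar_weak_type) (auto simp: H_def A_def intro: mean_less_imp)
      also have "\<dots> \<le> (\<integral>\<^sup>+x\<in>Q. g i x \<partial>M)"
        using H(2)[of i] by (intro nn_integral_mono) (auto simp: G_def split: split_indicator)
      also have "\<dots> = A * emeasure M Q"
        unfolding A_def using Qfin by (simp add: mean_times_emeasure)
      finally have "A * (K * emeasure M (\<Union>(H i))) \<le> A * emeasure M Q"
        by (simp add: ac_simps)
      then show ?thesis using A0 A_top by (simp add: ennreal_mult_le_mult_iff)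
    qed
    have "of_nat m * (2 * emeasure M (\<Union>G)) = K * emeasure M (\<Union>G)"
      by (simp add: K_def ac_simps)
    also have "\<dots> \<le> K * (\<Sum>i\<in>I. emeasure M (\<Union>(H i)))"
      using I UH cover
      by (intro mult_left_mono order_trans[OF emeasure_mono emeasure_subadditive_finite]) auto
    also have "\<dots> \<le> (\<Sum>i\<in>I. emeasure M Q)"
      unfolding sum_distrib_left by (intro sum_mono one)
    also have "\<dots> = of_nat m * emeasure M Q" by (simp add: m_def)
    finally have half: "2 * emeasure M (\<Union>G) \<le> emeasure M Q"
      using m by (subst (asm) ennreal_mult_le_mult_iff) (auto simp: ennreal_of_nat_neq_top)
    have rem: "remainder S Q = Q - \<Union>G" by (simp add: remainder_def G_def)
    have "emeasure M Q = emeasure M (\<Union>G) + emeasure M (remainder S Q)"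
      unfolding rem using emeasure_Un[of "\<Union>G" M Q] UG QM by (simp add: Un_absorb1)
    then have "emeasure M Q + emeasure M Q = 2 * emeasure M (\<Union>G) + 2 * emeasure M (remainder S Q)"
      by (metis distrib_left mult_2)
    also have "\<dots> \<le> emeasure M Q + 2 * emeasure M (remainder S Q)"
      using half by (intro add_right_mono)
    finally show ?thesis
      using Qfin by (auto simp: ennreal_add_left_cancel_le)
  qed
  have "K ^ m = of_nat ((2 * card I) ^ card I)"
    by (simp add: K_def m_def)
  then show ?thesis using SF dom sparse by metis
qed

lemma remainder_disjoint:
  assumes "laminar S"
  shows "disjoint_family_on (remainder S) S"
  unfolding disjoint_family_on_def
proof (intro ballI impI)
  fix Q R assume QR: "Q \<in> S" "R \<in> S" "Q \<noteq> R"
  then consider "Q \<inter> R = {}" | "Q \<subset> R" | "R \<subset> Q"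
    using assms unfolding laminar_def by (metis psubsetI)
  then show "remainder S Q \<inter> remainder S R = {}"
    using QR by cases (auto simp: remainder_def)
qed

text \<open>The weighted mean of \<open>f\<close> over \<open>Q\<close> is a constant that can be moved inside the mean of \<open>\<surd>\<sigma>\<close>
  and then be replaced by the weighted maximal function of \<open>f\<close>, which is at least as large on
  all of \<open>Q\<close>; this produces the function \<open>h\<close> of the proof. The remainders are disjoint, so the sum of their
  measures times squared means of \<open>h\<close> is at most the integral of the square of the unweighted maximal
  function of \<open>h\<close>. Two applications of Doob's inequality remove both maximal functions.\<close>

lemma sparse_sum_sqrt_weight:
  fixes f \<sigma> :: "'a \<Rightarrow> ennreal"
  assumes F: "finite F" "laminar F" "F \<subseteq> sets M"
    and fin: "\<And>Q. Q \<in> F \<Longrightarrow> emeasure M Q \<noteq> top"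
    and \<sigma>fin: "\<And>Q. Q \<in> F \<Longrightarrow> (\<integral>\<^sup>+x\<in>Q. \<sigma> x \<partial>M) \<noteq> top"
    and meas [measurable]: "f \<in> borel_measurable M" "\<sigma> \<in> borel_measurable M"
    and q: "1 < q"
    and S: "S \<subseteq> F" "\<And>Q. Q \<in> S \<Longrightarrow> emeasure M Q \<le> 2 * emeasure M (remainder S Q)"
  shows "(\<Sum>Q\<in>S. emeasure M Q * (epowr (mean (density M \<sigma>) Q f) q
            * epowr (mean M Q (\<lambda>x. epowr (\<sigma> x) (1/2))) 2))
    \<le> ennreal (2 * doob_const 2 * doob_const q) * (\<integral>\<^sup>+x. epowr (f x) q * \<sigma> x \<partial>M)"
proof -
  define N where "N = density M \<sigma>"
  have [simp]: "sets N = sets M" by (simp add: N_def)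
  have N_meas: "u \<in> borel_measurable N \<longleftrightarrow> u \<in> borel_measurable M" for u :: "'a \<Rightarrow> ennreal"
    by (simp add: N_def)
  define h where "h x = epowr (family_maximal N F f x) (q/2) * epowr (\<sigma> x) (1/2)" for x
  have "family_maximal N F f \<in> borel_measurable N"
    using F by (intro borel_measurable_family_maximal) (auto intro: countable_finite)
  then have [measurable]: "family_maximal N F f \<in> borel_measurable M"
    by (simp add: N_meas)
  have h_meas [measurable]: "h \<in> borel_measurable M"
    unfolding h_def by measurable
  have [measurable]: "family_maximal M F h \<in> borel_measurable M"
    using F by (intro borel_measurable_family_maximal) (auto intro: countable_finite)
  have rem_meas: "remainder S Q \<in> sets M" if "Q \<in> S" for Q
    unfolding remainder_def using F S that
    by (intro sets.Diff sets.finite_Union) (auto intro: finite_subset[OF _ F(1)])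
  have mean_h: "epowr (mean N Q f) q * epowr (mean M Q (\<lambda>x. epowr (\<sigma> x) (1/2))) 2 \<le> epowr (mean M Q h) 2"
    if "Q \<in> S" for Q
  proof -
    have QF: "Q \<in> F" "Q \<in> sets M" using that S F by auto
    have "epowr (mean N Q f) (q/2) * mean M Q (\<lambda>x. epowr (\<sigma> x) (1/2))
        = mean M Q (\<lambda>x. epowr (mean N Q f) (q/2) * epowr (\<sigma> x) (1/2))"
      using QF by (intro mean_cmult[symmetric]) auto
    also have "\<dots> \<le> mean M Q h"
      unfolding h_def using QF q
      by (intro mean_mono mult_right_mono epowr_mono mean_le_family_maximal) auto
    finally have "epowr (epowr (mean N Q f) (q/2) * mean M Q (\<lambda>x. epowr (\<sigma> x) (1/2))) 2 \<le> epowr (mean M Q h) 2"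
      by (intro epowr_mono) auto
    then show ?thesis by (simp add: epowr_mult epowr_epowr)
  qed
  have each: "emeasure M Q * (epowr (mean N Q f) q * epowr (mean M Q (\<lambda>x. epowr (\<sigma> x) (1/2))) 2)
      \<le> 2 * emeasure (density M (\<lambda>x. epowr (family_maximal M F h x) 2)) (remainder S Q)" if Q: "Q \<in> S" for Q
  proof -
    have "emeasure M Q * (epowr (mean N Q f) q * epowr (mean M Q (\<lambda>x. epowr (\<sigma> x) (1/2))) 2)
      \<le> (2 * emeasure M (remainder S Q)) * epowr (mean M Q h) 2"
      using Q by (intro mult_mono S mean_h) auto
    also have "\<dots> = 2 * (epowr (mean M Q h) 2 * emeasure M (remainder S Q))"
      by (simp add: ac_simps)
    also have "epowr (mean M Q h) 2 * emeasure M (remainder S Q)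
        = (\<integral>\<^sup>+x\<in>remainder S Q. epowr (mean M Q h) 2 \<partial>M)"
      using rem_meas[OF Q] by (simp add: nn_integral_cmult_indicator)
    also have "2 * \<dots> \<le> 2 * (\<integral>\<^sup>+x\<in>remainder S Q. epowr (family_maximal M F h x) 2 \<partial>M)"
      using Q S(1)
      by (intro mult_left_mono nn_integral_mono)
        (auto simp: remainder_def split: split_indicator intro!: epowr_mono mean_le_family_maximal)
    also have "\<dots> = 2 * emeasure (density M (\<lambda>x. epowr (family_maximal M F h x) 2)) (remainder S Q)"
      using rem_meas[OF Q] by (simp add: emeasure_density)
    finally show ?thesis .
  qed
  let ?D = "density M (\<lambda>x. epowr (family_maximal M F h x) 2)"
  have "(\<Sum>Q\<in>S. emeasure M Q * (epowr (mean N Q f) q * epowr (mean M Q (\<lambda>x. epowr (\<sigma> x) (1/2))) 2))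
      \<le> (\<Sum>Q\<in>S. 2 * emeasure ?D (remainder S Q))"
    by (intro sum_mono each)
  also have "\<dots> = 2 * emeasure ?D (\<Union>Q\<in>S. remainder S Q)"
  proof -
    have "(\<Sum>Q\<in>S. emeasure ?D (remainder S Q)) = emeasure ?D (\<Union>Q\<in>S. remainder S Q)"
      using rem_meas S(1) F(1,2)
      by (intro sum_emeasure remainder_disjoint)
        (auto intro: laminar_subset finite_subset)
    then show ?thesis by (simp flip: sum_distrib_left)
  qed
  also have "\<dots> \<le> 2 * emeasure ?D (space ?D)"
    by (intro mult_left_mono emeasure_space) auto
  also have "\<dots> = 2 * (\<integral>\<^sup>+x. epowr (family_maximal M F h x) 2 \<partial>M)"
    by (subst emeasure_density) (auto intro!: nn_integral_cong arg_cong[where f = "\<lambda>t. 2 * t"])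
  also have "\<dots> \<le> 2 * (ennreal (doob_const 2) * (\<integral>\<^sup>+x. epowr (h x) 2 \<partial>M))"
    using F fin by (intro mult_left_mono Doob_maximal_inequality) (auto simp: less_top)
  also have "(\<integral>\<^sup>+x. epowr (h x) 2 \<partial>M) = (\<integral>\<^sup>+x. \<sigma> x * epowr (family_maximal N F f x) q \<partial>M)"
    by (simp add: h_def epowr_mult epowr_epowr mult.commute)
  also have "\<dots> = (\<integral>\<^sup>+x. epowr (family_maximal N F f x) q \<partial>N)"
    by (rule nn_integral_density[symmetric, of \<sigma> M "\<lambda>x. epowr (family_maximal N F f x) q", folded N_def]) auto
  also have "\<dots> \<le> ennreal (doob_const q) * (\<integral>\<^sup>+x. epowr (f x) q \<partial>N)"
    using F \<sigma>fin q
    by (intro Doob_maximal_inequality) (auto simp: less_top N_def emeasure_density subset_eq)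
  also have "(\<integral>\<^sup>+x. epowr (f x) q \<partial>N) = (\<integral>\<^sup>+x. epowr (f x) q * \<sigma> x \<partial>M)"
    by (simp add: N_def nn_integral_density mult.commute)
  finally have "(\<Sum>Q\<in>S. emeasure M Q * (epowr (mean N Q f) q * epowr (mean M Q (\<lambda>x. epowr (\<sigma> x) (1/2))) 2))
    \<le> 2 * (ennreal (doob_const 2) * (ennreal (doob_const q) * (\<integral>\<^sup>+x. epowr (f x) q * \<sigma> x \<partial>M)))"
    by (simp add: mult_left_mono)
  also have "\<dots> = ennreal (2 * doob_const 2 * doob_const q) * (\<integral>\<^sup>+x. epowr (f x) q * \<sigma> x \<partial>M)"
    using doob_const_pos[of 2] doob_const_pos[OF q] by (simp add: ennreal_mult mult.assoc)
  finally show ?thesis unfolding N_def .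
qed

section \<open>The weighted inequality over a laminar family\<close>

definition laminar_const :: "'i set \<Rightarrow> ('i \<Rightarrow> real) \<Rightarrow> real \<Rightarrow> real" where
  "laminar_const I P p = real ((2 * card I) ^ card I) powr p
     * (\<Prod>i\<in>I. (2 * doob_const 2 * doob_const (P i)) powr (p / P i))"

lemma laminar_const_pos:
  assumes "finite I" "I \<noteq> {}" "\<And>i. i \<in> I \<Longrightarrow> 1 < P i"
  shows "0 < laminar_const I P p"
proof -
  have "0 < card I" using assms by (simp add: card_gt_0_iff)
  moreover have "0 < (2 * doob_const 2 * doob_const (P i)) powr (p / P i)" if "i \<in> I" for i
    using doob_const_pos[of 2] doob_const_pos[OF assms(3)[OF that]] by simp
  ultimately show ?thesis
    unfolding laminar_const_def by (intro mult_pos_pos prod_pos) auto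
qed

lemma mean_times_weight:
  assumes [measurable]: "f \<in> borel_measurable M" "\<sigma> \<in> borel_measurable M" "Q \<in> sets M"
    and "(\<integral>\<^sup>+x\<in>Q. \<sigma> x \<partial>M) \<noteq> 0" "(\<integral>\<^sup>+x\<in>Q. \<sigma> x \<partial>M) \<noteq> top"
  shows "mean M Q (\<lambda>x. f x * \<sigma> x) = mean (density M \<sigma>) Q f * mean M Q \<sigma>"
proof -
  have "mean M Q (\<lambda>x. f x * \<sigma> x) = (\<integral>\<^sup>+x\<in>Q. f x \<partial>density M \<sigma>) / emeasure M Q"
    by (simp add: mean_def nn_integral_density ac_simps)
  also have "(\<integral>\<^sup>+x\<in>Q. f x \<partial>density M \<sigma>) = mean (density M \<sigma>) Q f * (\<integral>\<^sup>+x\<in>Q. \<sigma> x \<partial>M)"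
    using mean_times_emeasure[of "density M \<sigma>" Q f] assms by (simp add: emeasure_density)
  finally show ?thesis by (simp add: mean_def ennreal_times_divide)
qed

text \<open>Sparse domination replaces the supremum by a sum over a sparse family, and the hypothesis on \<open>B\<close>
  trades \<open>v\<close> for the measure \<open>M\<close>. What remains is a product of powers with exponents \<open>p / P i\<close>
  of sum one, so Hoelder's inequality for sums reduces it to one weight at a time.\<close>

theorem laminar_weighted_inequality_finite:
  fixes f \<sigma> :: "'i \<Rightarrow> 'a \<Rightarrow> ennreal"
  assumes F: "finite F" "laminar F" "F \<subseteq> sets M"
    and fin: "\<And>Q. Q \<in> F \<Longrightarrow> emeasure M Q \<noteq> 0" "\<And>Q. Q \<in> F \<Longrightarrow> emeasure M Q \<noteq> top"
    and I: "finite I" "I \<noteq> {}"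
    and P: "\<And>i. i \<in> I \<Longrightarrow> 1 < P i" "1 / p = (\<Sum>i\<in>I. 1 / P i)"
    and f: "\<And>i. i \<in> I \<Longrightarrow> f i \<in> borel_measurable M"
    and \<sigma>: "\<And>i. i \<in> I \<Longrightarrow> \<sigma> i \<in> borel_measurable M"
    and v: "v \<in> borel_measurable M"
    and \<sigma>fin: "\<And>i Q. i \<in> I \<Longrightarrow> Q \<in> F \<Longrightarrow> (\<integral>\<^sup>+x\<in>Q. \<sigma> i x \<partial>M) \<noteq> 0"
      "\<And>i Q. i \<in> I \<Longrightarrow> Q \<in> F \<Longrightarrow> (\<integral>\<^sup>+x\<in>Q. \<sigma> i x \<partial>M) \<noteq> top"
    and B: "\<And>Q. Q \<in> F \<Longrightarrow> epowr (\<Prod>i\<in>I. mean M Q (\<sigma> i)) p * (\<integral>\<^sup>+x\<in>Q. v x \<partial>M)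
        \<le> B * (emeasure M Q * (\<Prod>i\<in>I. epowr (mean M Q (\<lambda>x. epowr (\<sigma> i x) (1/2))) (2 * (p / P i))))"
  shows "(\<integral>\<^sup>+x. epowr (SUP Q\<in>F. (\<Prod>i\<in>I. mean M Q (\<lambda>y. f i y * \<sigma> i y)) * indicator Q x) p * v x \<partial>M)
    \<le> ennreal (laminar_const I P p) * (B * (\<Prod>i\<in>I. epowr (\<integral>\<^sup>+x. epowr (f i x) (P i) * \<sigma> i x \<partial>M) (p / P i)))"
proof -
  define \<phi> where "\<phi> Q = (\<Prod>i\<in>I. mean M Q (\<lambda>y. f i y * \<sigma> i y))" for Q
  define a :: ennreal where "a = of_nat ((2 * card I) ^ card I)"
  have "0 < (\<Sum>i\<in>I. 1 / P i)"
    using I P(1) by (intro sum_pos) (auto intro: less_trans[OF zero_less_one])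
  then have p: "0 < p" using P(2) by (metis zero_less_divide_1_iff)
  have Ppos: "0 < P i" if "i \<in> I" for i using P(1)[OF that] by simp
  have \<theta>: "(\<Sum>i\<in>I. p / P i) = 1"
  proof -
    have "(\<Sum>i\<in>I. p / P i) = p * (\<Sum>i\<in>I. 1 / P i)" by (simp add: sum_distrib_left)
    also have "\<dots> = 1" using p by (simp flip: P(2))
    finally show ?thesis .
  qed
  have [measurable]: "(\<lambda>x. f i x * \<sigma> i x) \<in> borel_measurable M" if "i \<in> I" for i
    using f[OF that] \<sigma>[OF that] by measurable
  note v [measurable]
  obtain S where S: "S \<subseteq> F" "\<And>Q. Q \<in> F \<Longrightarrow> \<exists>R\<in>S. Q \<subseteq> R \<and> \<phi> Q \<le> a * \<phi> R"
    "\<And>Q. Q \<in> S \<Longrightarrow> emeasure M Q \<le> 2 * emeasure M (remainder S Q)"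
    using sparse_domination[OF F fin I, of "\<lambda>i x. f i x * \<sigma> i x"] unfolding \<phi>_def a_def by auto
  have finS: "finite S" using S(1) F(1) by (rule finite_subset)
  have SM: "Q \<in> sets M" if "Q \<in> S" for Q using that S(1) F(3) by auto
  define X where "X i Q = emeasure M Q * (epowr (mean (density M (\<sigma> i)) Q (f i)) (P i)
            * epowr (mean M Q (\<lambda>x. epowr (\<sigma> i x) (1/2))) 2)" for i Q
  have pointwise: "epowr (SUP Q\<in>F. \<phi> Q * indicator Q x) p \<le> (\<Sum>R\<in>S. epowr (a * \<phi> R) p * indicator R x)" for x
    unfolding epowr_le_iff[OF p]
  proof (rule SUP_least)
    fix Q assume "Q \<in> F"
    from S(2)[OF this] obtain R where R: "R \<in> S" "Q \<subseteq> R" "\<phi> Q \<le> a * \<phi> R" by auto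
    have "epowr (\<phi> Q * indicator Q x) p \<le> epowr (a * \<phi> R) p * indicator R x"
      using R p by (auto intro!: epowr_mono split: split_indicator)
    also have "\<dots> \<le> (\<Sum>R\<in>S. epowr (a * \<phi> R) p * indicator R x)"
      using R(1) finS by (intro member_le_sum) auto
    finally show "\<phi> Q * indicator Q x \<le> epowr (\<Sum>R\<in>S. epowr (a * \<phi> R) p * indicator R x) (1 / p)"
      unfolding epowr_le_iff[OF p] .
  qed
  have each: "epowr (\<phi> R) p * (\<integral>\<^sup>+x\<in>R. v x \<partial>M) \<le> B * (\<Prod>i\<in>I. epowr (X i R) (p / P i))" if R: "R \<in> S" for R
  proof -
    have RF: "R \<in> F" using R S(1) by auto
    let ?A = "\<lambda>i. mean (density M (\<sigma> i)) R (f i)"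
    let ?H = "\<lambda>i. mean M R (\<lambda>x. epowr (\<sigma> i x) (1/2))"
    have "\<phi> R = (\<Prod>i\<in>I. ?A i) * (\<Prod>i\<in>I. mean M R (\<sigma> i))"
      unfolding \<phi>_def prod.distrib[symmetric]
      using f \<sigma> \<sigma>fin RF SM[OF R] by (intro prod.cong refl mean_times_weight) auto
    then have "epowr (\<phi> R) p * (\<integral>\<^sup>+x\<in>R. v x \<partial>M)
        = (\<Prod>i\<in>I. epowr (?A i) p) * (epowr (\<Prod>i\<in>I. mean M R (\<sigma> i)) p * (\<integral>\<^sup>+x\<in>R. v x \<partial>M))"
      using I by (simp add: epowr_mult epowr_prod mult.assoc)
    also have "\<dots> \<le> (\<Prod>i\<in>I. epowr (?A i) p) * (B * (emeasure M R * (\<Prod>i\<in>I. epowr (?H i) (2 * (p / P i)))))"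
      by (intro mult_left_mono B RF) auto
    also have "\<dots> = B * (emeasure M R * (\<Prod>i\<in>I. epowr (?A i) p * epowr (?H i) (2 * (p / P i))))"
      by (simp add: prod.distrib ac_simps)
    also have "emeasure M R = (\<Prod>i\<in>I. epowr (emeasure M R) (p / P i))"
      using epowr_sum[OF I, of "emeasure M R" "\<lambda>i. p / P i"] \<theta> by simp
    also have "(\<Prod>i\<in>I. epowr (emeasure M R) (p / P i)) * (\<Prod>i\<in>I. epowr (?A i) p * epowr (?H i) (2 * (p / P i)))
        = (\<Prod>i\<in>I. epowr (X i R) (p / P i))"
      unfolding prod.distrib[symmetric] using Ppos
      by (intro prod.cong refl) (simp add: X_def epowr_mult epowr_epowr less_imp_neq[symmetric])
    finally show ?thesis .
  qed
  have "(\<integral>\<^sup>+x. epowr (SUP Q\<in>F. \<phi> Q * indicator Q x) p * v x \<partial>M)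
      \<le> (\<integral>\<^sup>+x. (\<Sum>R\<in>S. epowr (a * \<phi> R) p * (v x * indicator R x)) \<partial>M)"
  proof (rule nn_integral_mono)
    fix x
    have "epowr (SUP Q\<in>F. \<phi> Q * indicator Q x) p * v x \<le> (\<Sum>R\<in>S. epowr (a * \<phi> R) p * indicator R x) * v x"
      by (intro mult_right_mono pointwise) auto
    then show "epowr (SUP Q\<in>F. \<phi> Q * indicator Q x) p * v x \<le> (\<Sum>R\<in>S. epowr (a * \<phi> R) p * (v x * indicator R x))"
      by (simp add: sum_distrib_left ac_simps)
  qed
  also have "\<dots> = (\<Sum>R\<in>S. epowr (a * \<phi> R) p * (\<integral>\<^sup>+x\<in>R. v x \<partial>M))"
    using SM by (subst nn_integral_sum) (auto intro!: sum.cong nn_integral_cmult)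
  also have "\<dots> = epowr a p * (\<Sum>R\<in>S. epowr (\<phi> R) p * (\<integral>\<^sup>+x\<in>R. v x \<partial>M))"
    by (simp add: epowr_mult sum_distrib_left mult.assoc)
  also have "\<dots> \<le> epowr a p * (\<Sum>R\<in>S. B * (\<Prod>i\<in>I. epowr (X i R) (p / P i)))"
    by (intro mult_left_mono sum_mono each) auto
  also have "\<dots> = epowr a p * (B * (\<Sum>R\<in>S. \<Prod>i\<in>I. epowr (X i R) (p / P i)))"
    by (simp add: sum_distrib_left)
  also have "\<dots> \<le> epowr a p * (B * (\<Prod>i\<in>I. epowr (\<Sum>R\<in>S. X i R) (p / P i)))"
    using I finS \<theta> p Ppos by (intro mult_left_mono Hoelder_inequality_sum) auto
  also have "\<dots> \<le> epowr a p * (B * (\<Prod>i\<in>I. epowr (ennreal (2 * doob_const 2 * doob_const (P i))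
      * (\<integral>\<^sup>+x. epowr (f i x) (P i) * \<sigma> i x \<partial>M)) (p / P i)))"
  proof (intro mult_left_mono prod_mono_ennreal epowr_mono)
    fix i assume i: "i \<in> I"
    show "(\<Sum>R\<in>S. X i R) \<le> ennreal (2 * doob_const 2 * doob_const (P i)) * (\<integral>\<^sup>+x. epowr (f i x) (P i) * \<sigma> i x \<partial>M)"
      unfolding X_def
      by (rule sparse_sum_sqrt_weight[OF F fin(2) \<sigma>fin(2)[OF i] f[OF i] \<sigma>[OF i] P(1)[OF i] S(1,3)]) auto
    show "0 \<le> p / P i" using p Ppos[OF i] by simp
  qed auto
  also have "\<dots> = (epowr a p * (\<Prod>i\<in>I. epowr (ennreal (2 * doob_const 2 * doob_const (P i))) (p / P i)))
      * (B * (\<Prod>i\<in>I. epowr (\<integral>\<^sup>+x. epowr (f i x) (P i) * \<sigma> i x \<partial>M) (p / P i)))"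
    by (simp add: epowr_mult prod.distrib ac_simps)
  also have "epowr a p * (\<Prod>i\<in>I. epowr (ennreal (2 * doob_const 2 * doob_const (P i))) (p / P i))
      = ennreal (laminar_const I P p)"
  proof -
    have "epowr a p = ennreal (real ((2 * card I) ^ card I) powr p)"
      unfolding a_def ennreal_of_nat_eq_real_of_nat by (rule epowr_ennreal) simp
    moreover have "(\<Prod>i\<in>I. epowr (ennreal (2 * doob_const 2 * doob_const (P i))) (p / P i))
        = ennreal (\<Prod>i\<in>I. (2 * doob_const 2 * doob_const (P i)) powr (p / P i))"
    proof (subst prod_ennreal[symmetric])
      show "(\<Prod>i\<in>I. epowr (ennreal (2 * doob_const 2 * doob_const (P i))) (p / P i))
          = (\<Prod>i\<in>I. ennreal ((2 * doob_const 2 * doob_const (P i)) powr (p / P i)))"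
        using doob_const_pos[of 2] doob_const_pos[OF P(1)]
        by (intro prod.cong refl epowr_ennreal mult_nonneg_nonneg) (auto intro: less_imp_le)
    qed auto
    ultimately show ?thesis
      by (simp add: laminar_const_def ennreal_mult prod_nonneg)
  qed
  finally show ?thesis unfolding \<phi>_def .
qed

text \<open>For a countable family, exhaust it by finite ones.\<close>

corollary laminar_weighted_inequality:
  fixes f \<sigma> :: "'i \<Rightarrow> 'a \<Rightarrow> ennreal"
  assumes F: "countable F" "laminar F" "F \<subseteq> sets M"
    and fin: "\<And>Q. Q \<in> F \<Longrightarrow> emeasure M Q \<noteq> 0" "\<And>Q. Q \<in> F \<Longrightarrow> emeasure M Q \<noteq> top"
    and I: "finite I" "I \<noteq> {}"
    and P: "\<And>i. i \<in> I \<Longrightarrow> 1 < P i" "1 / p = (\<Sum>i\<in>I. 1 / P i)"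
    and f: "\<And>i. i \<in> I \<Longrightarrow> f i \<in> borel_measurable M"
    and \<sigma>: "\<And>i. i \<in> I \<Longrightarrow> \<sigma> i \<in> borel_measurable M"
    and v: "v \<in> borel_measurable M"
    and \<sigma>fin: "\<And>i Q. i \<in> I \<Longrightarrow> Q \<in> F \<Longrightarrow> (\<integral>\<^sup>+x\<in>Q. \<sigma> i x \<partial>M) \<noteq> 0"
      "\<And>i Q. i \<in> I \<Longrightarrow> Q \<in> F \<Longrightarrow> (\<integral>\<^sup>+x\<in>Q. \<sigma> i x \<partial>M) \<noteq> top"
    and B: "\<And>Q. Q \<in> F \<Longrightarrow> epowr (\<Prod>i\<in>I. mean M Q (\<sigma> i)) p * (\<integral>\<^sup>+x\<in>Q. v x \<partial>M)
        \<le> B * (emeasure M Q * (\<Prod>i\<in>I. epowr (mean M Q (\<lambda>x. epowr (\<sigma> i x) (1/2))) (2 * (p / P i))))"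
  shows "(\<integral>\<^sup>+x. epowr (SUP Q\<in>F. (\<Prod>i\<in>I. mean M Q (\<lambda>y. f i y * \<sigma> i y)) * indicator Q x) p * v x \<partial>M)
    \<le> ennreal (laminar_const I P p) * (B * (\<Prod>i\<in>I. epowr (\<integral>\<^sup>+x. epowr (f i x) (P i) * \<sigma> i x \<partial>M) (p / P i)))"
    (is "_ \<le> ?K")
proof (cases "F = {}")
  case True
  then show ?thesis by (simp add: bot_ennreal)
next
  case False
  define \<phi> where "\<phi> Q = (\<Prod>i\<in>I. mean M Q (\<lambda>y. f i y * \<sigma> i y))" for Q
  define G where "G n = from_nat_into F ` {..n}" for n
  have G: "finite (G n)" "G n \<subseteq> F" for n
    using from_nat_into[OF False] by (auto simp: G_def)
  have UG: "F = (\<Union>n. G n)"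
    using G(2) from_nat_into_surj[OF F(1)] by (fastforce simp: G_def)
  have "0 < (\<Sum>i\<in>I. 1 / P i)"
    using I P(1) by (intro sum_pos) (auto intro: less_trans[OF zero_less_one])
  then have p: "0 < p" using P(2) by (metis zero_less_divide_1_iff)
  define u where "u n x = (SUP Q\<in>G n. \<phi> Q * indicator Q x)" for n x
  have u_meas [measurable]: "u n \<in> borel_measurable M" for n
    unfolding u_def[abs_def]
  proof (intro borel_measurable_SUP countable_finite G(1))
    fix Q assume "Q \<in> G n"
    then have [measurable]: "Q \<in> sets M" using G(2) F(3) by blast
    show "(\<lambda>x. \<phi> Q * indicator Q x) \<in> borel_measurable M" by measurable
  qed
  note v [measurable]
  have mono: "u m x \<le> u n x" if "m \<le> n" for m n x
    unfolding u_def using that by (intro SUP_subset_mono) (auto simp: G_def)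
  have "(SUP Q\<in>F. \<phi> Q * indicator Q x) = (SUP n. u n x)" for x
    unfolding u_def UG by (rule SUP_UNION)
  then have "(\<integral>\<^sup>+x. epowr (SUP Q\<in>F. \<phi> Q * indicator Q x) p * v x \<partial>M)
      \<le> (\<integral>\<^sup>+x. (SUP n. epowr (u n x) p * v x) \<partial>M)"
  proof (intro nn_integral_mono)
    fix x
    assume eq: "\<And>x. (SUP Q\<in>F. \<phi> Q * indicator Q x) = (SUP n. u n x)"
    have "epowr (SUP n. u n x) p \<le> (SUP n. epowr (u n x) p)"
      unfolding epowr_le_iff[OF p]
      by (rule SUP_least) (auto simp: epowr_le_iff[OF p, symmetric] intro: SUP_upper)
    then have "epowr (SUP n. u n x) p * v x \<le> (SUP n. epowr (u n x) p) * v x"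
      by (rule mult_right_mono) simp
    then show "epowr (SUP Q\<in>F. \<phi> Q * indicator Q x) p * v x \<le> (SUP n. epowr (u n x) p * v x)"
      by (simp add: eq SUP_mult_right_ennreal)
  qed
  also have "\<dots> = (SUP n. \<integral>\<^sup>+x. epowr (u n x) p * v x \<partial>M)"
    using mono p
    by (intro nn_integral_monotone_convergence_SUP)
      (auto simp: incseq_def le_fun_def intro!: mult_right_mono epowr_mono)
  also have "\<dots> \<le> ?K"
  proof (rule SUP_least)
    fix n
    have Gn: "Q \<in> F" if "Q \<in> G n" for Q using that G(2) by auto
    show "(\<integral>\<^sup>+x. epowr (u n x) p * v x \<partial>M) \<le> ?K"
      unfolding u_def \<phi>_def
      using G F(3) f \<sigma> v
      by (intro laminar_weighted_inequality_finite laminar_subset[OF F(2)] fin[OF Gn] I P \<sigma>fin[OF _ Gn] B[OF Gn]) auto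
  qed
  finally show ?thesis unfolding \<phi>_def .
qed

section \<open>Shifted dyadic grids\<close>

text \<open>A cell is given by the integer parts of its points, so that the nesting of cells is the
  compatibility of integer parts with division by powers of two.\<close>

definition dyadic_cell :: "real ^ 'n \<Rightarrow> int \<Rightarrow> int ^ 'n \<Rightarrow> (real ^ 'n) set" where
  "dyadic_cell t k j = {x. \<forall>i. \<lfloor>(x $ i - t $ i) / 2 powr k\<rfloor> = j $ i}"

definition dyadic_grid :: "real ^ 'n \<Rightarrow> (real ^ 'n) set set" where
  "dyadic_grid t = range (\<lambda>(k, j). dyadic_cell t k j)"

definition third_shift :: "nat \<Rightarrow> 'n set \<Rightarrow> real ^ 'n" where
  "third_shift N A = (\<chi> i. if i \<in> A then 2 ^ N / 3 else 0)"

lemma countable_dyadic_grid: "countable (dyadic_grid t)"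
  unfolding dyadic_grid_def by (intro countable_image) simp

lemma floor_dyadic_refine:
  assumes "k \<le> l" "\<lfloor>x / 2 powr real_of_int k\<rfloor> = \<lfloor>y / 2 powr real_of_int k\<rfloor>"
  shows "\<lfloor>x / 2 powr real_of_int l\<rfloor> = \<lfloor>y / 2 powr real_of_int l\<rfloor>"
proof -
  define c :: int where "c = 2 ^ nat (l - k)"
  have "(2::real) powr l = 2 powr k * 2 powr (real (nat (l - k)))"
    using assms(1) by (simp flip: powr_add)
  then have c: "2 powr real_of_int l = 2 powr real_of_int k * real_of_int c"
    by (simp add: c_def powr_realpow)
  have "\<lfloor>z / 2 powr real_of_int l\<rfloor> = \<lfloor>z / 2 powr real_of_int k\<rfloor> div c" for z
    unfolding c by (subst divide_divide_eq_left[symmetric], rule floor_divide_real_eq_div) (simp add: c_def)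
  with assms(2) show ?thesis by simp
qed

lemma laminar_dyadic_grid: "laminar (dyadic_grid t)"
proof -
  have *: "dyadic_cell t k j \<inter> dyadic_cell t l j' = {} \<or> dyadic_cell t k j \<subseteq> dyadic_cell t l j'"
    if "k \<le> l" for k l j j'
  proof (cases "dyadic_cell t k j \<inter> dyadic_cell t l j' = {}")
    case False
    then obtain x where x: "x \<in> dyadic_cell t k j" "x \<in> dyadic_cell t l j'" by auto
    have "z \<in> dyadic_cell t l j'" if z: "z \<in> dyadic_cell t k j" for z
      unfolding dyadic_cell_def
    proof (intro CollectI allI)
      fix i
      have "\<lfloor>(z $ i - t $ i) / 2 powr real_of_int k\<rfloor> = \<lfloor>(x $ i - t $ i) / 2 powr real_of_int k\<rfloor>"
        using x(1) z by (simp add: dyadic_cell_def)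
      from floor_dyadic_refine[OF \<open>k \<le> l\<close> this] x(2)
      show "\<lfloor>(z $ i - t $ i) / 2 powr real_of_int l\<rfloor> = j' $ i"
        by (simp add: dyadic_cell_def)
    qed
    then show ?thesis by blast
  qed simp
  have "dyadic_cell t k j \<inter> dyadic_cell t l j' = {} \<or> dyadic_cell t k j \<subseteq> dyadic_cell t l j'
      \<or> dyadic_cell t l j' \<subseteq> dyadic_cell t k j" for k l j j'
    using *[of k l j j'] *[of l k j' j] by (cases "k \<le> l") (auto simp: Int_commute)
  then show ?thesis
    unfolding laminar_def dyadic_grid_def by blast
qed

text \<open>The cells are half-open, to be nested or disjoint, whereas the constant is defined with closed
  cubes. The two differ by null sets, which means do not see.\<close>

lemma dyadic_cell_cube:
  fixes t :: "real ^ 'n"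
  defines "a k j \<equiv> (\<chi> i. t $ i + 2 powr real_of_int k * real_of_int (j $ i))"
  shows "box (a k j) (\<chi> i. a k j $ i + 2 powr k) \<subseteq> dyadic_cell t k j"
    and "dyadic_cell t k j \<subseteq> cbox (a k j) (\<chi> i. a k j $ i + 2 powr k)"
proof -
  have *: "\<lfloor>y / 2 powr real_of_int k\<rfloor> = z \<longleftrightarrow>
      2 powr real_of_int k * real_of_int z \<le> y \<and> y < 2 powr real_of_int k * real_of_int z + 2 powr real_of_int k" for y z
    by (simp add: floor_eq_iff field_simps)
  have eq: "x \<in> dyadic_cell t k j \<longleftrightarrow> (\<forall>i. a k j $ i \<le> x $ i \<and> x $ i < a k j $ i + 2 powr real_of_int k)" for x
    unfolding dyadic_cell_def mem_Collect_eq * a_def by (auto simp: algebra_simps)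
  show "box (a k j) (\<chi> i. a k j $ i + 2 powr k) \<subseteq> dyadic_cell t k j"
    by (auto simp: eq mem_box_cart less_imp_le)
  show "dyadic_cell t k j \<subseteq> cbox (a k j) (\<chi> i. a k j $ i + 2 powr k)"
    by (auto simp: eq mem_box_cart less_imp_le)
qed

lemma between_box_cbox:
  fixes a b :: "real ^ 'n"
  assumes "box a b \<subseteq> R" "R \<subseteq> cbox a b"
  shows "R \<in> sets lebesgue" "AE x in lebesgue. x \<in> R \<longleftrightarrow> x \<in> cbox a b"
proof -
  have "negligible (cbox a b - R)"
    using negligible_frontier_interval[of a b] assms by (rule_tac negligible_subset) auto
  then have null: "cbox a b - R \<in> null_sets lebesgue"
    by (simp add: negligible_iff_null_sets)
  have "cbox a b - (cbox a b - R) \<in> sets lebesgue"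
    by (rule sets.Diff[OF _ null_setsD2[OF null]]) simp
  then show "R \<in> sets lebesgue" using assms(2) by (simp add: double_diff)
  show "AE x in lebesgue. x \<in> R \<longleftrightarrow> x \<in> cbox a b"
    using AE_not_in[OF null] by eventually_elim (use assms in auto)
qed

lemma dyadic_grid_cube:
  fixes R :: "(real ^ 'n) set"
  assumes "R \<in> dyadic_grid t"
  obtains Q where "Q \<in> cubes" "R \<in> sets lebesgue" "AE x in lebesgue. x \<in> R \<longleftrightarrow> x \<in> Q"
proof -
  obtain k j where R: "R = dyadic_cell t k j"
    using assms by (auto simp: dyadic_grid_def)
  define a :: "real ^ 'n" where "a = (\<chi> i. t $ i + 2 powr real_of_int k * real_of_int (j $ i))"
  note between_box_cbox[OF dyadic_cell_cube[of t k j]]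
  moreover have "cbox a (\<chi> i. a $ i + 2 powr k) \<in> cubes"
    unfolding cubes_def by (intro CollectI exI[of _ a] exI[of _ "2 powr real_of_int k"]) auto
  ultimately show thesis using that unfolding R a_def by blast
qed

lemma emeasure_cube:
  fixes a :: "real ^ 'n"
  assumes "0 < s"
  shows "emeasure lebesgue (cbox a (\<chi> i. a $ i + s)) = ennreal (s ^ CARD('n))"
proof -
  have "measure lborel (cbox a (\<chi> i. a $ i + s)) = s ^ CARD('n)"
    using assms content_cbox_if_cart[of a "\<chi> i. a $ i + s"] interval_eq_empty_cart
    by (auto simp: interval_eq_empty_cart)
  then show ?thesis
    using emeasure_eq_ennreal_measure[of lborel "cbox a (\<chi> i. a $ i + s)"] emeasure_lborel_cbox_finite[of a]
    by (simp add: less_top)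
qed

text \<open>A half-open interval of length at most a third of the mesh cannot contain a point of the grid
  \<open>2\<^sup>k \<int>\<close> and a point of its translate by \<open>2\<^sup>N / 3\<close>: as three does not divide \<open>2\<^sup>N\<^sup>-\<^sup>k\<close>, the two
  grids are at least \<open>2\<^sup>k / 3\<close> apart. The translation is the same at all scales \<open>k \<le> N\<close>, so the translated
  cells of different scales are still nested.\<close>

lemma one_third_trick:
  assumes s: "0 \<le> s" "3 * s \<le> 2 powr real_of_int k" and k: "k \<le> int N"
  shows "\<exists>\<tau>\<in>{0, 2 ^ N / 3}. \<lfloor>(a - \<tau>) / 2 powr real_of_int k\<rfloor> = \<lfloor>(a + s - \<tau>) / 2 powr real_of_int k\<rfloor>"
proof (rule ccontr)
  assume neg: "\<not> ?thesis"
  define \<delta> where "\<delta> = (2::real) powr real_of_int k"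
  have \<delta>: "0 < \<delta>" by (simp add: \<delta>_def)
  have pt: "\<exists>u::int. a - \<tau> < u * \<delta> \<and> u * \<delta> \<le> a + s - \<tau>" if "\<tau> \<in> {0, 2 ^ N / 3}" for \<tau>
  proof -
    have ne: "\<lfloor>(a - \<tau>) / \<delta>\<rfloor> \<noteq> \<lfloor>(a + s - \<tau>) / \<delta>\<rfloor>"
      using neg that unfolding \<delta>_def by blast
    have "(a - \<tau>) / \<delta> \<le> (a + s - \<tau>) / \<delta>"
      using s \<delta> by (intro divide_right_mono) auto
    then have "\<lfloor>(a - \<tau>) / \<delta>\<rfloor> < \<lfloor>(a + s - \<tau>) / \<delta>\<rfloor>"
      using floor_mono ne by (metis order_le_less)
    then have "(a - \<tau>) / \<delta> < real_of_int \<lfloor>(a + s - \<tau>) / \<delta>\<rfloor>"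
      by (simp add: floor_less_iff)
    moreover have "real_of_int \<lfloor>(a + s - \<tau>) / \<delta>\<rfloor> \<le> (a + s - \<tau>) / \<delta>" by simp
    ultimately show ?thesis
      unfolding pos_divide_less_eq[OF \<delta>] pos_le_divide_eq[OF \<delta>] by blast
  qed
  obtain u :: int where u: "a < u * \<delta>" "u * \<delta> \<le> a + s"
    using pt[of 0] by auto
  obtain w :: int where w: "a - 2 ^ N / 3 < w * \<delta>" "w * \<delta> \<le> a + s - 2 ^ N / 3"
    using pt[of "2 ^ N / 3"] by auto
  define e where "e = nat (int N - k)"
  have "(2::real) ^ N = 2 powr real N" by (simp add: powr_realpow)
  also have "\<dots> = \<delta> * 2 powr real e"
    using k by (simp add: \<delta>_def e_def flip: powr_add)
  finally have N: "(2::real) ^ N = \<delta> * 2 ^ e" by (simp add: powr_realpow)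
  define d where "d = 3 * (u - w) - 2 ^ e"
  have "real_of_int d * \<delta> = 3 * (u * \<delta> - w * \<delta> - 2 ^ N / 3)"
    unfolding N by (simp add: d_def algebra_simps)
  moreover have "\<bar>3 * (u * \<delta> - w * \<delta> - 2 ^ N / 3)\<bar> < \<delta>"
    using u w s by (auto simp: \<delta>_def[symmetric])
  ultimately have "\<bar>real_of_int d * \<delta>\<bar> < \<delta>"
    by (simp only:)
  then have "\<bar>real_of_int d\<bar> * \<delta> < 1 * \<delta>"
    using \<delta> by (simp add: abs_mult)
  then have "\<bar>real_of_int d\<bar> < 1" using \<delta> by (simp only: mult_less_cancel_right_pos)
  then have "d = 0" by linarith
  then have "(3::int) dvd 2 ^ e" unfolding d_def by (metis dvd_triv_left eq_iff_diff_eq_0)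
  moreover have "coprime (3::int) (2 ^ e)" by (simp add: coprime_power_right_iff)
  ultimately have "is_unit (3::int)" by (rule coprime_common_divisor[OF _ dvd_refl, rotated])
  then show False by simp
qed

text \<open>Each coordinate chooses its own translate. The scale \<open>k\<close> is the least one permitted by the
  one-third trick, so that \<open>3 s \<le> 2\<^sup>k \<le> 6 s\<close> for the side \<open>s\<close> of the cube.\<close>

lemma cube_in_dyadic_grid:
  fixes Q :: "(real ^ 'n) set"
  assumes "Q \<in> cubes"
  shows "\<exists>N0. \<forall>N\<ge>N0. \<exists>A. \<exists>R\<in>dyadic_grid (third_shift N A).
    Q \<subseteq> R \<and> emeasure lebesgue R \<le> ennreal (6 ^ CARD('n)) * emeasure lebesgue Q"
proof -
  obtain a s where Q: "Q = cbox a (\<chi> i. a $ i + s)" and s: "0 < s"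
    using assms by (auto simp: cubes_def)
  define k where "k = \<lceil>log 2 (3 * s)\<rceil>"
  have "log 2 (3 * s) \<le> k" "k < log 2 (3 * s) + 1"
    unfolding k_def by linarith+
  then have "2 powr (log 2 (3 * s)) \<le> 2 powr k" "2 powr k < 2 powr (log 2 (3 * s) + 1)"
    by (intro powr_mono powr_less_mono; simp)+
  then have k: "3 * s \<le> 2 powr k" "2 powr k \<le> 6 * s"
    using s by (auto simp: powr_add)
  show ?thesis
  proof (intro exI[of _ "nat k"] allI impI)
    fix N assume N: "nat k \<le> N"
    have "\<forall>i. \<exists>\<tau>\<in>{0, 2 ^ N / 3}. \<lfloor>(a $ i - \<tau>) / 2 powr real_of_int k\<rfloor> = \<lfloor>(a $ i + s - \<tau>) / 2 powr real_of_int k\<rfloor>"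
      using one_third_trick[of s k N] s k(1) N by auto
    then obtain \<tau> where \<tau>: "\<And>i. \<tau> i \<in> {0, 2 ^ N / 3}"
      "\<And>i. \<lfloor>(a $ i - \<tau> i) / 2 powr real_of_int k\<rfloor> = \<lfloor>(a $ i + s - \<tau> i) / 2 powr real_of_int k\<rfloor>"
      by metis
    define A where "A = {i. \<tau> i \<noteq> 0}"
    define t where "t = third_shift N A"
    have t: "t $ i = \<tau> i" for i
      using \<tau>(1)[of i] by (auto simp: t_def third_shift_def A_def)
    define j where "j = (\<chi> i. \<lfloor>(a $ i - \<tau> i) / 2 powr real_of_int k\<rfloor>)"
    define R where "R = dyadic_cell t k j"
    have "Q \<subseteq> R"
    proof
      fix x assume "x \<in> Q"
      then have x: "a $ i \<le> x $ i" "x $ i \<le> a $ i + s" for i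
        by (auto simp: Q mem_box_cart)
      show "x \<in> R"
        unfolding R_def dyadic_cell_def
      proof (intro CollectI allI)
        fix i
        have "\<lfloor>(a $ i - \<tau> i) / 2 powr real_of_int k\<rfloor> \<le> \<lfloor>(x $ i - \<tau> i) / 2 powr real_of_int k\<rfloor>"
          "\<lfloor>(x $ i - \<tau> i) / 2 powr real_of_int k\<rfloor> \<le> \<lfloor>(a $ i + s - \<tau> i) / 2 powr real_of_int k\<rfloor>"
          using x[of i] by (intro floor_mono divide_right_mono; simp)+
        then show "\<lfloor>(x $ i - t $ i) / 2 powr real_of_int k\<rfloor> = j $ i"
          using \<tau>(2)[of i] by (simp add: t j_def)
      qed
    qed
    moreover have "emeasure lebesgue R \<le> ennreal (6 ^ CARD('n)) * emeasure lebesgue Q"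
    proof -
      have "emeasure lebesgue R \<le> ennreal ((2 powr real_of_int k) ^ CARD('n))"
        unfolding R_def
        by (rule order_trans[OF emeasure_mono[OF dyadic_cell_cube(2)] eq_refl[OF emeasure_cube]]) auto
      also have "\<dots> \<le> ennreal ((6 * s) ^ CARD('n))"
        using k(2) by (intro ennreal_leI power_mono) auto
      also have "\<dots> = ennreal (6 ^ CARD('n)) * emeasure lebesgue Q"
        unfolding Q emeasure_cube[OF s] using s by (simp add: power_mult_distrib ennreal_mult)
      finally show ?thesis .
    qed
    moreover have "R \<in> dyadic_grid t"
      by (auto simp: R_def dyadic_grid_def)
    ultimately show "\<exists>A. \<exists>R\<in>dyadic_grid (third_shift N A).
        Q \<subseteq> R \<and> emeasure lebesgue R \<le> ennreal (6 ^ CARD('n)) * emeasure lebesgue Q"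
      unfolding t_def by blast
  qed
qed

section \<open>Weights and the constant of the theorem\<close>

lemma weight_measurable:
  assumes "weight w"
  shows "w \<in> borel_measurable lebesgue"
proof (rule borel_measurable_LIMSEQ_real)
  fix n :: nat
  have "w absolutely_integrable_on cball 0 (real n)"
    using assms by (simp add: weight_def)
  then show "(\<lambda>x. indicat_real (cball 0 (real n)) x *\<^sub>R w x) \<in> borel_measurable lebesgue"
    unfolding set_integrable_def by (rule borel_measurable_integrable)
next
  fix x :: "real ^ 'a"
  obtain N :: nat where "norm x \<le> real N" using real_arch_simple by blast
  then have "\<forall>\<^sub>F n in sequentially. indicat_real (cball 0 (real n)) x *\<^sub>R w x = w x"
    by (intro eventually_sequentiallyI[of N]) (auto split: split_indicator)
  then show "(\<lambda>n. indicat_real (cball 0 (real n)) x *\<^sub>R w x) \<longlonglongrightarrow> w x"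
    by (rule tendsto_eventually)
qed

lemma weight_pos: "weight w \<Longrightarrow> AE x in lebesgue. 0 < w x"
  by (simp add: weight_def)

lemma cube_compact: "Q \<in> cubes \<Longrightarrow> compact Q"
  by (auto simp: cubes_def)

lemma cube_sets: "Q \<in> cubes \<Longrightarrow> Q \<in> sets lebesgue"
  by (auto simp: cubes_def)

lemma weight_integrable_cube: "weight w \<Longrightarrow> Q \<in> cubes \<Longrightarrow> set_integrable lebesgue Q w"
  by (simp add: weight_def cube_compact)

lemma emeasure_cube_pos_finite:
  assumes "Q \<in> cubes"
  shows "emeasure lebesgue Q \<noteq> 0" "emeasure lebesgue Q \<noteq> top"
  using assms by (auto simp: cubes_def emeasure_cube simp del: emeasure_completion)

lemma cube_emeasure_eq_measure:
  assumes "Q \<in> cubes"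
  shows "emeasure lebesgue Q = ennreal (measure lebesgue Q)" "0 < measure lebesgue Q"
proof -
  show *: "emeasure lebesgue Q = ennreal (measure lebesgue Q)"
    using emeasure_cube_pos_finite(2)[OF assms] by (rule emeasure_eq_ennreal_measure)
  show "0 < measure lebesgue Q"
    using emeasure_cube_pos_finite(1)[OF assms] unfolding * by (simp add: zero_less_measure_iff)
qed

lemma mean_eq_average:
  assumes Q: "Q \<in> cubes" and g: "set_integrable lebesgue Q g" "AE x in lebesgue. 0 < g x"
  shows "mean lebesgue Q (\<lambda>x. ennreal (g x)) = ennreal (average Q g)" "0 < average Q g"
    "(\<integral>\<^sup>+x\<in>Q. ennreal (g x) \<partial>lebesgue) \<noteq> 0" "(\<integral>\<^sup>+x\<in>Q. ennreal (g x) \<partial>lebesgue) \<noteq> top"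
proof -
  have int: "integrable lebesgue (\<lambda>x. indicator Q x *\<^sub>R g x)"
    using g(1) by (simp add: set_integrable_def)
  have nonneg: "AE x in lebesgue. 0 \<le> indicator Q x *\<^sub>R g x"
    using g(2) by eventually_elim (auto split: split_indicator)
  have "(\<integral>\<^sup>+x\<in>Q. ennreal (g x) \<partial>lebesgue) = (\<integral>\<^sup>+x. ennreal (indicator Q x *\<^sub>R g x) \<partial>lebesgue)"
    by (intro nn_integral_cong) (auto split: split_indicator)
  also have "\<dots> = ennreal (LINT x:Q|lebesgue. g x)"
    unfolding set_lebesgue_integral_def by (rule nn_integral_eq_integral[OF int nonneg])
  finally have eq: "(\<integral>\<^sup>+x\<in>Q. ennreal (g x) \<partial>lebesgue) = ennreal (LINT x:Q|lebesgue. g x)" .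
  have nonneg': "0 \<le> (LINT x:Q|lebesgue. g x)"
    unfolding set_lebesgue_integral_def using nonneg by (rule integral_nonneg_AE)
  have "(LINT x:Q|lebesgue. g x) \<noteq> 0"
  proof
    assume "(LINT x:Q|lebesgue. g x) = 0"
    then have "AE x in lebesgue. indicator Q x *\<^sub>R g x = 0"
      unfolding set_lebesgue_integral_def using integral_nonneg_eq_0_iff_AE[OF int nonneg] by simp
    with g(2) have "AE x in lebesgue. x \<notin> Q"
      by eventually_elim (auto split: split_indicator_asm)
    then have "emeasure lebesgue Q = 0"
      using cube_sets[OF Q] by (simp add: AE_iff_measurable[OF _ refl] del: emeasure_completion)
    then show False using emeasure_cube_pos_finite(1)[OF Q] by blast
  qed
  with nonneg' have pos: "0 < (LINT x:Q|lebesgue. g x)" by simp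
  then show "0 < average Q g"
    unfolding average_def using cube_emeasure_eq_measure(2)[OF Q] by (rule divide_pos_pos)
  show "mean lebesgue Q (\<lambda>x. ennreal (g x)) = ennreal (average Q g)"
    unfolding mean_def eq cube_emeasure_eq_measure(1)[OF Q] average_def
    by (rule divide_ennreal[OF nonneg' cube_emeasure_eq_measure(2)[OF Q]])
  show "(\<integral>\<^sup>+x\<in>Q. ennreal (g x) \<partial>lebesgue) \<noteq> 0" "(\<integral>\<^sup>+x\<in>Q. ennreal (g x) \<partial>lebesgue) \<noteq> top"
    unfolding eq using pos by auto
qed

lemma average_const:
  assumes "Q \<in> cubes"
  shows "set_integrable lebesgue Q (\<lambda>x. c :: real)" "average Q (\<lambda>x. c) = c"
proof -
  have Q: "Q \<in> sets lebesgue" "emeasure lebesgue Q < \<infinity>"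
    using cube_sets[OF assms] emeasure_cube_pos_finite(2)[OF assms] by (auto simp: less_top)
  show "set_integrable lebesgue Q (\<lambda>x. c :: real)"
    unfolding set_integrable_def using Q
    by (intro integrable_scaleR_left integrable_real_indicator) auto
  have "(LINT x:Q|lebesgue. c) = measure lebesgue Q * c"
    unfolding set_lebesgue_integral_def using Q by simp
  then show "average Q (\<lambda>x. c) = c"
    using cube_emeasure_eq_measure(2)[OF assms] by (simp add: average_def)
qed

lemma average_sum:
  assumes "finite I" "\<And>i. i \<in> I \<Longrightarrow> set_integrable lebesgue Q (g i)"
  shows "average Q (\<lambda>x. \<Sum>i\<in>I. g i x) = (\<Sum>i\<in>I. average Q (g i))"
  using assms(2) unfolding average_def set_lebesgue_integral_def set_integrable_def scaleR_sum_right sum_divide_distrib[symmetric]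
  by (subst Bochner_Integration.integral_sum) auto

lemma average_cmult: "average Q (\<lambda>x. c * g x) = c * average Q g"
  by (simp add: average_def)

text \<open>Jensen's inequality for the logarithm: average the tangent line bound
  \<open>ln h \<le> ln A + h / A - 1\<close> at the mean value \<open>A\<close> of \<open>h\<close>.\<close>

lemma exp_average_ln_le:
  assumes Q: "Q \<in> cubes" and h: "set_integrable lebesgue Q h" "AE x in lebesgue. 0 < h x"
    and ln: "set_integrable lebesgue Q (\<lambda>x. ln (h x))"
  shows "exp (average Q (\<lambda>x. ln (h x))) \<le> average Q h"
proof -
  define A where "A = average Q h"
  have A: "0 < A" unfolding A_def by (rule mean_eq_average(2)[OF Q h])
  have int: "set_integrable lebesgue Q (\<lambda>x. (ln A - 1) + (1 / A) * h x)"
    by (intro set_integral_add(1) average_const(1)[OF Q] set_integrable_mult_right h(1))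
  have "(LINT x:Q|lebesgue. ln (h x)) \<le> (LINT x:Q|lebesgue. (ln A - 1) + (1 / A) * h x)"
  proof (rule set_integral_mono_AE[OF ln int])
    show "AE x\<in>Q in lebesgue. ln (h x) \<le> (ln A - 1) + (1 / A) * h x"
      using h(2)
    proof eventually_elim
      case (elim x)
      then have "ln (h x / A) \<le> h x / A - 1" using A by (intro ln_le_minus_one) auto
      then show ?case using elim A by (simp add: ln_div)
    qed
  qed
  also have "\<dots> = (LINT x:Q|lebesgue. ln A - 1) + (1 / A) * (LINT x:Q|lebesgue. h x)"
    using h(1) average_const(1)[OF Q]
    by (subst set_integral_add(2)) (auto intro!: set_integrable_mult_right)
  finally have "(LINT x:Q|lebesgue. ln (h x)) / measure lebesgue Q
      \<le> ((LINT x:Q|lebesgue. ln A - 1) + (1 / A) * (LINT x:Q|lebesgue. h x)) / measure lebesgue Q"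
    by (intro divide_right_mono measure_nonneg)
  then have "average Q (\<lambda>x. ln (h x)) \<le> average Q (\<lambda>x. ln A - 1) + (1 / A) * average Q h"
    unfolding average_def by (simp only: add_divide_distrib times_divide_eq_right)
  also have "\<dots> = ln A"
    using A by (simp add: average_const(2)[OF Q] A_def[symmetric])
  finally show ?thesis unfolding A_def[symmetric] using A by (simp add: ln_ge_iff)
qed

lemma sqrt_weight_integrable:
  assumes "weight \<sigma>" "Q \<in> cubes"
  shows "set_integrable lebesgue Q (\<lambda>x. \<sigma> x powr (1/2))"
proof (rule set_integrable_bound)
  note [measurable] = weight_measurable[OF assms(1)] cube_sets[OF assms(2)]
  show "set_integrable lebesgue Q (\<lambda>x. 1 + \<sigma> x)"
    by (intro set_integral_add(1) average_const(1) weight_integrable_cube assms)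
  show "set_borel_measurable lebesgue Q (\<lambda>x. \<sigma> x powr (1/2))"
    unfolding set_borel_measurable_def by measurable
  show "AE x in lebesgue. x \<in> Q \<longrightarrow> norm (\<sigma> x powr (1/2)) \<le> norm (1 + \<sigma> x)"
    using weight_pos[OF assms(1)]
  proof eventually_elim
    case (elim x)
    have "\<sigma> x powr (1/2) \<le> 1 + \<sigma> x"
    proof (cases "\<sigma> x \<le> 1")
      case True
      then have "\<sigma> x powr (1/2) \<le> 1" using elim by (intro powr_le1) auto
      then show ?thesis using elim by simp
    next
      case False
      then have "\<sigma> x powr (1/2) \<le> \<sigma> x powr 1" by (intro powr_mono) auto
      then show ?thesis using elim by simp
    qed
    then show ?case using elim by simp
  qed
qed

text \<open>Both a weight and its dual weight are integrable, and up to a factor their logarithms are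
  negatives of each other, so \<open>ln t \<le> t\<close> bounds the logarithm on both sides.\<close>

lemma ln_dual_weight_integrable:
  assumes "1 < q" "weight w" "weight (dual_weight q w)" "Q \<in> cubes"
  shows "set_integrable lebesgue Q (\<lambda>x. ln (dual_weight q w x))"
proof (rule set_integrable_bound)
  note [measurable] = weight_measurable[OF assms(3)] cube_sets[OF assms(4)]
  show "set_integrable lebesgue Q (\<lambda>x. dual_weight q w x + (1 / (q - 1)) * w x)"
    by (intro set_integral_add(1) set_integrable_mult_right weight_integrable_cube assms)
  show "set_borel_measurable lebesgue Q (\<lambda>x. ln (dual_weight q w x))"
    unfolding set_borel_measurable_def by measurable
  show "AE x in lebesgue. x \<in> Q \<longrightarrow> norm (ln (dual_weight q w x)) \<le> norm (dual_weight q w x + (1 / (q - 1)) * w x)"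
    using weight_pos[OF assms(2)]
  proof eventually_elim
    case (elim x)
    have pos: "0 < dual_weight q w x" using elim by (simp add: dual_weight_def)
    have "1 - conj_exponent q = - (1 / (q - 1))"
      using assms(1) by (simp add: conj_exponent_def field_simps)
    then have "ln (dual_weight q w x) = - ((1 / (q - 1)) * ln (w x))"
      using elim by (simp add: dual_weight_def ln_powr)
    moreover have "(1 / (q - 1)) * ln (w x) \<le> (1 / (q - 1)) * w x"
      using assms(1) elim ln_le_minus_one[of "w x"] by (intro mult_left_mono) auto
    moreover have "ln (dual_weight q w x) \<le> dual_weight q w x"
      using ln_le_minus_one[OF pos] by simp
    moreover have "0 \<le> (1 / (q - 1)) * w x" using assms(1) elim by simp
    ultimately have "\<bar>ln (dual_weight q w x)\<bar> \<le> dual_weight q w x + (1 / (q - 1)) * w x"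
      using pos by linarith
    then show ?case by simp
  qed
qed

text \<open>The only way in which the constant enters the proof. It contains a negative power of the
  geometric mean of each \<open>\<sigma> i\<close>, which by Jensen's inequality for \<open>\<surd>\<sigma>\<close> is at least the same power of the
  squared mean of \<open>\<surd>\<sigma>\<close>.\<close>

lemma B_constant_testing:
  fixes v :: "real ^ 'n \<Rightarrow> real" and w :: "nat \<Rightarrow> real ^ 'n \<Rightarrow> real"
  assumes P: "\<And>i. i \<in> {1..m} \<Longrightarrow> 1 < P i" and p: "0 < p"
    and v: "weight v" and w: "\<And>i. i \<in> {1..m} \<Longrightarrow> weight (w i)"
    and \<sigma>: "\<sigma> = (\<lambda>i. dual_weight (P i) (w i))" "\<And>i. i \<in> {1..m} \<Longrightarrow> weight (\<sigma> i)"
    and Q: "Q \<in> cubes"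
  shows "epowr (\<Prod>i\<in>{1..m}. mean lebesgue Q (\<lambda>x. ennreal (\<sigma> i x))) p * (\<integral>\<^sup>+x\<in>Q. ennreal (v x) \<partial>lebesgue)
    \<le> B_constant m P p v \<sigma> * (emeasure lebesgue Q
        * (\<Prod>i\<in>{1..m}. epowr (mean lebesgue Q (\<lambda>x. epowr (ennreal (\<sigma> i x)) (1/2))) (2 * (p / P i))))"
proof -
  define V where "V = average Q v"
  define S where "S i = average Q (\<sigma> i)" for i
  define H where "H i = average Q (\<lambda>x. \<sigma> i x powr (1/2))" for i
  define L where "L i = average Q (\<lambda>x. ln (\<sigma> i x))" for i
  have V: "mean lebesgue Q (\<lambda>x. ennreal (v x)) = ennreal V" "0 < V"
    using mean_eq_average[OF Q weight_integrable_cube[OF v Q] weight_pos[OF v]] by (auto simp: V_def)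
  have S: "mean lebesgue Q (\<lambda>x. ennreal (\<sigma> i x)) = ennreal (S i)" "0 < S i" if "i \<in> {1..m}" for i
    using mean_eq_average[OF Q weight_integrable_cube[OF \<sigma>(2) Q] weight_pos[OF \<sigma>(2)]] that by (auto simp: S_def)
  have \<sigma>nn: "0 \<le> \<sigma> i x" for i x by (simp add: \<sigma>(1) dual_weight_def)
  have sqrt_pos: "AE x in lebesgue. 0 < \<sigma> i x powr (1/2)" if "i \<in> {1..m}" for i
    using weight_pos[OF \<sigma>(2)[OF that]] by eventually_elim simp
  have H: "mean lebesgue Q (\<lambda>x. epowr (ennreal (\<sigma> i x)) (1/2)) = ennreal (H i)" "0 < H i" if "i \<in> {1..m}" for i
    using mean_eq_average[OF Q sqrt_weight_integrable[OF \<sigma>(2)[OF that] Q] sqrt_pos[OF that]]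
    by (auto simp: H_def epowr_ennreal \<sigma>nn)
  have ln_int: "set_integrable lebesgue Q (\<lambda>x. ln (\<sigma> i x))" if i: "i \<in> {1..m}" for i
    using ln_dual_weight_integrable[OF P w _ Q, OF i i] \<sigma>(2)[OF i] by (simp add: \<sigma>(1))
  have HL: "exp (L i) \<le> H i powr 2" if i: "i \<in> {1..m}" for i
  proof -
    have ln_sqrt: "ln (\<sigma> i x powr (1/2)) = (1/2) * ln (\<sigma> i x)" for x
      using \<sigma>nn[of i x] by (cases "\<sigma> i x = 0") (auto simp: ln_powr)
    have "exp (average Q (\<lambda>x. ln (\<sigma> i x powr (1/2)))) \<le> H i"
      unfolding H_def
    proof (rule exp_average_ln_le[OF Q sqrt_weight_integrable[OF \<sigma>(2)[OF i] Q] sqrt_pos[OF i]])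
      show "set_integrable lebesgue Q (\<lambda>x. ln (\<sigma> i x powr (1/2)))"
        unfolding ln_sqrt by (intro set_integrable_mult_right ln_int i)
    qed
    moreover have "average Q (\<lambda>x. ln (\<sigma> i x powr (1/2))) = L i / 2"
      unfolding ln_sqrt L_def average_def by simp
    ultimately have "exp (L i / 2) \<le> H i" by metis
    then have "exp (L i / 2) powr 2 \<le> H i powr 2"
      by (intro powr_mono2) auto
    then show ?thesis by (simp add: exp_powr_real)
  qed
  have "average Q (\<lambda>x. ln (\<Prod>i\<in>{1..m}. \<sigma> i x powr (- (p / P i))))
      = average Q (\<lambda>x. \<Sum>i\<in>{1..m}. - (p / P i) * ln (\<sigma> i x))"
  proof -
    have "AE x in lebesgue. \<forall>i\<in>{1..m}. 0 < \<sigma> i x"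
      using weight_pos[OF \<sigma>(2)] by (intro AE_finite_allI) auto
    then have ae: "AE x in lebesgue. ln (\<Prod>i\<in>{1..m}. \<sigma> i x powr (- (p / P i))) = (\<Sum>i\<in>{1..m}. - (p / P i) * ln (\<sigma> i x))"
    proof eventually_elim
      case (elim x)
      have "(\<Prod>i\<in>{1..m}. \<sigma> i x powr (- (p / P i))) = exp (\<Sum>i\<in>{1..m}. - (p / P i) * ln (\<sigma> i x))"
        using elim by (auto simp: exp_sum powr_def intro!: prod.cong)
      then show ?case by simp
    qed
    have [measurable]: "\<sigma> i \<in> borel_measurable lebesgue" if "i \<in> {1..m}" for i
      using weight_measurable[OF \<sigma>(2)[OF that]] .
    show ?thesis
      unfolding average_def
      using ae by (intro arg_cong2[where f = "(/)"] refl set_lebesgue_integral_cong_AE cube_sets[OF Q]) auto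
  qed
  also have "\<dots> = (\<Sum>i\<in>{1..m}. - (p / P i) * L i)"
    by (subst average_sum) (auto intro!: set_integrable_mult_right ln_int simp only: L_def average_cmult)
  finally have lnprod: "average Q (\<lambda>x. ln (\<Prod>i\<in>{1..m}. \<sigma> i x powr (- (p / P i)))) = (\<Sum>i\<in>{1..m}. - (p / P i) * L i)" .
  have exp_ge: "1 \<le> exp (\<Sum>i\<in>{1..m}. - (p / P i) * L i) * (\<Prod>i\<in>{1..m}. H i powr (2 * (p / P i)))"
  proof -
    have "1 \<le> (\<Prod>i\<in>{1..m}. exp (- (p / P i) * L i) * H i powr (2 * (p / P i)))"
    proof (rule prod_ge_1)
      fix i assume i: "i \<in> {1..m}"
      have "exp (L i) powr (p / P i) \<le> (H i powr 2) powr (p / P i)"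
        using HL[OF i] p P[OF i] by (intro powr_mono2) auto
      then have "exp ((p / P i) * L i) \<le> H i powr (2 * (p / P i))"
        by (simp add: exp_powr_real powr_powr mult.commute)
      then have "exp (- (p / P i) * L i) * exp ((p / P i) * L i) \<le> exp (- (p / P i) * L i) * H i powr (2 * (p / P i))"
        by (intro mult_left_mono) auto
      then show "1 \<le> exp (- (p / P i) * L i) * H i powr (2 * (p / P i))"
        by (simp flip: exp_add)
    qed
    then show ?thesis by (simp add: prod.distrib exp_sum)
  qed
  define T where "T = V * (\<Prod>i\<in>{1..m}. S i) powr p"
  define E where "E = exp (\<Sum>i\<in>{1..m}. - (p / P i) * L i)"
  define Z where "Z = (\<Prod>i\<in>{1..m}. H i powr (2 * (p / P i)))"
  have Z: "0 \<le> Z" unfolding Z_def by (intro prod_nonneg) auto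
  have T: "0 \<le> T" using V(2) by (simp add: T_def)
  have "T \<le> (T * E) * Z"
    using mult_left_mono[OF exp_ge[folded E_def Z_def] T] by (simp add: mult.assoc)
  then have "ennreal T \<le> ennreal (T * E) * ennreal Z"
    using T Z by (simp add: E_def ennreal_leI flip: ennreal_mult)
  also have "ennreal (T * E) \<le> B_constant m P p v \<sigma>"
    unfolding B_constant_def
    by (rule SUP_upper2[OF Q]) (simp only: T_def E_def V_def S_def lnprod order_refl)
  finally have main: "ennreal T \<le> B_constant m P p v \<sigma> * ennreal Z"
    by (simp add: mult_right_mono)
  have "(\<Prod>i\<in>{1..m}. mean lebesgue Q (\<lambda>x. ennreal (\<sigma> i x))) = ennreal (\<Prod>i\<in>{1..m}. S i)"
    using S by (subst prod_ennreal[symmetric]) (auto intro!: prod.cong less_imp_le)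
  moreover have "0 \<le> (\<Prod>i\<in>{1..m}. S i)" using S(2) by (intro prod_nonneg) (auto intro: less_imp_le)
  moreover have "(\<integral>\<^sup>+x\<in>Q. ennreal (v x) \<partial>lebesgue) = ennreal V * emeasure lebesgue Q"
    using mean_times_emeasure[OF emeasure_cube_pos_finite[OF Q]] V(1) by metis
  ultimately have "epowr (\<Prod>i\<in>{1..m}. mean lebesgue Q (\<lambda>x. ennreal (\<sigma> i x))) p * (\<integral>\<^sup>+x\<in>Q. ennreal (v x) \<partial>lebesgue)
      = ennreal T * emeasure lebesgue Q"
    using V(2) by (simp add: epowr_ennreal T_def ennreal_mult ac_simps del: emeasure_completion)
  also have "\<dots> \<le> (B_constant m P p v \<sigma> * ennreal Z) * emeasure lebesgue Q"
    by (intro mult_right_mono main) auto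
  also have "ennreal Z = (\<Prod>i\<in>{1..m}. epowr (mean lebesgue Q (\<lambda>x. epowr (ennreal (\<sigma> i x)) (1/2))) (2 * (p / P i)))"
    unfolding Z_def
    by (subst prod_ennreal[symmetric]) (auto intro!: prod.cong simp: H epowr_ennreal less_imp_le)
  finally show ?thesis by (simp add: ac_simps del: emeasure_completion)
qed

section \<open>From cubes to dyadic grids\<close>

lemma mean_cong_AE_set:
  assumes "AE x in M. x \<in> R \<longleftrightarrow> x \<in> Q" "R \<in> sets M" "Q \<in> sets M"
  shows "emeasure M R = emeasure M Q" "(\<integral>\<^sup>+x\<in>R. g x \<partial>M) = (\<integral>\<^sup>+x\<in>Q. g x \<partial>M)" "mean M R g = mean M Q g"
proof -
  show 1: "emeasure M R = emeasure M Q" using assms by (rule emeasure_eq_AE)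
  show 2: "(\<integral>\<^sup>+x\<in>R. g x \<partial>M) = (\<integral>\<^sup>+x\<in>Q. g x \<partial>M)"
    using assms(1) by (intro nn_integral_cong_AE) (auto simp: indicator_def elim!: eventually_mono)
  show "mean M R g = mean M Q g" by (simp only: mean_def 1 2)
qed

lemma mean_le_mean_superset:
  assumes "Q \<subseteq> R" "emeasure M R \<le> d * emeasure M Q"
    and Q: "emeasure M Q \<noteq> 0" "emeasure M Q \<noteq> top" and R: "emeasure M R \<noteq> 0" "emeasure M R \<noteq> top"
  shows "mean M Q g \<le> d * mean M R g"
proof -
  have "emeasure M R * mean M Q g \<le> (d * emeasure M Q) * mean M Q g"
    using assms(2) by (rule mult_right_mono) simp
  also have "\<dots> = d * (\<integral>\<^sup>+x\<in>Q. g x \<partial>M)"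
    using mean_times_emeasure[OF Q, of g] by (simp add: ac_simps)
  also have "\<dots> \<le> d * (\<integral>\<^sup>+x\<in>R. g x \<partial>M)"
    using assms(1) by (intro mult_left_mono nn_integral_mono) (auto split: split_indicator)
  also have "\<dots> = emeasure M R * (d * mean M R g)"
    using mean_times_emeasure[OF R, of g] by (simp add: ac_simps)
  finally show ?thesis using R by (simp add: ennreal_mult_le_mult_iff)
qed

definition grid_maximal :: "'i set \<Rightarrow> ('i \<Rightarrow> real ^ 'n \<Rightarrow> ennreal) \<Rightarrow> real ^ 'n \<Rightarrow> real ^ 'n \<Rightarrow> ennreal" where
  "grid_maximal I g t x = (SUP R\<in>dyadic_grid t. (\<Prod>i\<in>I. mean lebesgue R (g i)) * indicator R x)"

lemma dyadic_grid_sets: "R \<in> dyadic_grid t \<Longrightarrow> R \<in> sets lebesgue"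
  by (elim dyadic_grid_cube)

lemma emeasure_dyadic_grid:
  assumes "R \<in> dyadic_grid t"
  shows "emeasure lebesgue R \<noteq> 0" "emeasure lebesgue R \<noteq> top"
proof -
  obtain Q where Q: "Q \<in> cubes" "R \<in> sets lebesgue" "AE x in lebesgue. x \<in> R \<longleftrightarrow> x \<in> Q"
    using dyadic_grid_cube[OF assms] by blast
  have "emeasure lebesgue R = emeasure lebesgue Q"
    by (rule mean_cong_AE_set(1)[OF Q(3,2) cube_sets[OF Q(1)]])
  then show "emeasure lebesgue R \<noteq> 0" "emeasure lebesgue R \<noteq> top"
    using emeasure_cube_pos_finite[OF Q(1)] by (simp_all only:) auto
qed

lemma borel_measurable_grid_maximal [measurable]:
  fixes t :: "real ^ 'n"
  shows "grid_maximal I g t \<in> borel_measurable lebesgue"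
  unfolding grid_maximal_def[abs_def]
proof (intro borel_measurable_SUP countable_dyadic_grid)
  fix R :: "(real ^ 'n) set" assume "R \<in> dyadic_grid t"
  from dyadic_grid_sets[OF this] have [measurable]: "R \<in> sets lebesgue" .
  show "(\<lambda>x. (\<Prod>i\<in>I. mean lebesgue R (g i)) * indicator R x) \<in> borel_measurable lebesgue" by measurable
qed

text \<open>For every cube the one-third trick works as soon as the shifts are large enough,
  whence a lower limit instead of a supremum over the shifts.\<close>

lemma multi_maximal_le_liminf_grids:
  fixes g :: "nat \<Rightarrow> real ^ 'n \<Rightarrow> real"
  assumes p: "0 < p"
  shows "epowr (multi_maximal m g x) p
    \<le> liminf (\<lambda>N. \<Sum>A\<in>UNIV. epowr (ennreal ((6 ^ CARD('n)) ^ m)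
         * grid_maximal {1..m} (\<lambda>i y. ennreal \<bar>g i y\<bar>) (third_shift N A) x) p)"
    (is "_ \<le> liminf ?Z")
  unfolding epowr_le_iff[OF p] multi_maximal_def
proof (rule SUP_least)
  fix Q :: "(real ^ 'n) set" assume "Q \<in> {Q \<in> cubes. x \<in> Q}"
  then have Q: "Q \<in> cubes" "x \<in> Q" by auto
  let ?g = "\<lambda>i y. ennreal \<bar>g i y\<bar>"
  define d :: ennreal where "d = ennreal (6 ^ CARD('n))"
  obtain N0 where N0: "\<And>N. N0 \<le> N \<Longrightarrow> \<exists>A. \<exists>R\<in>dyadic_grid (third_shift N A).
    Q \<subseteq> R \<and> emeasure lebesgue R \<le> d * emeasure lebesgue Q"
    using cube_in_dyadic_grid[OF Q(1)] unfolding d_def by metis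
  have "epowr (\<Prod>i\<in>{1..m}. mean lebesgue Q (?g i)) p \<le> ?Z N" if N: "N0 \<le> N" for N
  proof -
    obtain A R where R: "R \<in> dyadic_grid (third_shift N A)" "Q \<subseteq> R" "emeasure lebesgue R \<le> d * emeasure lebesgue Q"
      using N0[OF N] by blast
    have "(\<Prod>i\<in>{1..m}. mean lebesgue Q (?g i)) \<le> (\<Prod>i\<in>{1..m}. d * mean lebesgue R (?g i))"
      by (intro prod_mono_ennreal mean_le_mean_superset R(2,3) emeasure_cube_pos_finite[OF Q(1)] emeasure_dyadic_grid[OF R(1)])
    also have "\<dots> = ennreal ((6 ^ CARD('n)) ^ m) * (\<Prod>i\<in>{1..m}. mean lebesgue R (?g i))"
      by (simp add: prod.distrib d_def ennreal_power)
    also have "\<dots> \<le> ennreal ((6 ^ CARD('n)) ^ m) * grid_maximal {1..m} ?g (third_shift N A) x"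
      unfolding grid_maximal_def using R(2) Q(2)
      by (intro mult_left_mono SUP_upper2[OF R(1)]) auto
    finally have "epowr (\<Prod>i\<in>{1..m}. mean lebesgue Q (?g i)) p
        \<le> epowr (ennreal ((6 ^ CARD('n)) ^ m) * grid_maximal {1..m} ?g (third_shift N A) x) p"
      using p by (intro epowr_mono) auto
    also have "\<dots> \<le> ?Z N"
      by (intro member_le_sum) auto
    finally show ?thesis .
  qed
  then have "epowr (\<Prod>i\<in>{1..m}. mean lebesgue Q (?g i)) p \<le> liminf ?Z"
    by (intro Liminf_bounded eventually_sequentiallyI[of N0])
  then show "(\<Prod>i\<in>{1..m}. (\<integral>\<^sup>+y\<in>Q. ?g i y \<partial>lebesgue) / emeasure lebesgue Q) \<le> epowr (liminf ?Z) (1 / p)"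
    by (simp only: epowr_le_iff[OF p] mean_def)
qed

lemma liminf_mult_right_le:
  fixes Z :: "nat \<Rightarrow> ennreal"
  shows "liminf Z * c \<le> liminf (\<lambda>n. Z n * c)"
proof -
  have "liminf Z * c = (SUP n. (INF k\<in>{n..}. Z k) * c)"
    by (simp add: liminf_SUP_INF SUP_mult_right_ennreal)
  also have "\<dots> \<le> (SUP n. INF k\<in>{n..}. Z k * c)"
    by (intro SUP_mono' INF_greatest mult_right_mono INF_lower) auto
  finally show ?thesis by (simp add: liminf_SUP_INF)
qed

text \<open>Fatou's lemma passes from the shifted grids to the maximal function over all cubes.\<close>

lemma multi_maximal_le_of_grids:
  fixes g :: "nat \<Rightarrow> real ^ 'n \<Rightarrow> real"
  assumes p: "0 < p" and v: "v \<in> borel_measurable lebesgue"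
    and grid: "\<And>t. (\<integral>\<^sup>+x. epowr (grid_maximal {1..m} (\<lambda>i y. ennreal \<bar>g i y\<bar>) t x) p * v x \<partial>lebesgue) \<le> K"
  shows "(\<integral>\<^sup>+x. epowr (multi_maximal m g x) p * v x \<partial>lebesgue)
    \<le> ennreal (2 ^ CARD('n) * ((6 ^ CARD('n)) ^ m) powr p) * K"
proof -
  note v [measurable]
  let ?G = "\<lambda>N A x. grid_maximal {1..m} (\<lambda>i y. ennreal \<bar>g i y\<bar>) (third_shift N A) x"
  define c :: real where "c = (6 ^ CARD('n)) ^ m"
  have c: "0 \<le> c" by (simp add: c_def)
  define Z where "Z N x = (\<Sum>A\<in>UNIV. epowr (ennreal c * ?G N A x) p)" for N and x :: "real ^ 'n"
  have [measurable]: "Z N \<in> borel_measurable lebesgue" for N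
    unfolding Z_def by measurable
  have "(\<integral>\<^sup>+x. epowr (multi_maximal m g x) p * v x \<partial>lebesgue)
      \<le> (\<integral>\<^sup>+x. liminf (\<lambda>N. Z N x * v x) \<partial>lebesgue)"
  proof (rule nn_integral_mono)
    fix x
    have "epowr (multi_maximal m g x) p * v x \<le> liminf (\<lambda>N. Z N x) * v x"
      unfolding Z_def c_def by (intro mult_right_mono multi_maximal_le_liminf_grids p) auto
    also have "\<dots> \<le> liminf (\<lambda>N. Z N x * v x)" by (rule liminf_mult_right_le)
    finally show "epowr (multi_maximal m g x) p * v x \<le> liminf (\<lambda>N. Z N x * v x)" .
  qed
  also have "\<dots> \<le> liminf (\<lambda>N. \<integral>\<^sup>+x. Z N x * v x \<partial>lebesgue)"
    by (rule nn_integral_liminf) measurable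
  also have "\<dots> \<le> liminf (\<lambda>N::nat. ennreal (2 ^ CARD('n) * c powr p) * K)"
  proof (intro Liminf_mono always_eventually allI)
    fix N
    have "(\<integral>\<^sup>+x. Z N x * v x \<partial>lebesgue)
        = (\<integral>\<^sup>+x. (\<Sum>A\<in>UNIV. epowr (ennreal c) p * (epowr (?G N A x) p * v x)) \<partial>lebesgue)"
      by (simp add: Z_def sum_distrib_right epowr_mult mult.assoc)
    also have "\<dots> = (\<Sum>A\<in>UNIV. epowr (ennreal c) p * (\<integral>\<^sup>+x. epowr (?G N A x) p * v x \<partial>lebesgue))"
      by (subst nn_integral_sum) (auto intro!: sum.cong nn_integral_cmult)
    also have "\<dots> \<le> (\<Sum>A\<in>(UNIV :: 'n set set). epowr (ennreal c) p * K)"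
      by (intro sum_mono mult_left_mono grid) auto
    also have "\<dots> = of_nat (2 ^ CARD('n)) * (ennreal (c powr p) * K)"
      using c by (simp add: card_UNIV_set epowr_ennreal)
    also have "\<dots> = ennreal (2 ^ CARD('n) * c powr p) * K"
      using c by (simp only: ennreal_of_nat_eq_real_of_nat of_nat_power of_nat_numeral) (simp add: ennreal_mult mult.assoc)
    finally show "(\<integral>\<^sup>+x. Z N x * v x \<partial>lebesgue) \<le> ennreal (2 ^ CARD('n) * c powr p) * K" .
  qed
  also have "\<dots> = ennreal (2 ^ CARD('n) * c powr p) * K"
    by (simp add: Liminf_const)
  finally show ?thesis unfolding c_def .
qed

section \<open>The weighted inequality on Euclidean space\<close>

lemma grid_maximal_weighted_inequality:
  fixes v :: "real ^ 'n \<Rightarrow> real" and w :: "nat \<Rightarrow> real ^ 'n \<Rightarrow> real"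
  assumes m: "1 \<le> m" and P: "\<And>i. i \<in> {1..m} \<Longrightarrow> 1 < P i" and p: "0 < p" "1 / p = (\<Sum>i\<in>{1..m}. 1 / P i)"
    and v: "weight v" and w: "\<And>i. i \<in> {1..m} \<Longrightarrow> weight (w i)"
    and \<sigma>: "\<sigma> = (\<lambda>i. dual_weight (P i) (w i))" "\<And>i. i \<in> {1..m} \<Longrightarrow> weight (\<sigma> i)"
    and f: "\<And>i. i \<in> {1..m} \<Longrightarrow> f i \<in> borel_measurable lebesgue"
  shows "(\<integral>\<^sup>+x. epowr (grid_maximal {1..m} (\<lambda>i y. ennreal \<bar>f i y * \<sigma> i y\<bar>) t x) p * ennreal (v x) \<partial>lebesgue)
    \<le> ennreal (laminar_const {1..m} P p) * (B_constant m P p v \<sigma>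
        * (\<Prod>i\<in>{1..m}. epowr (\<integral>\<^sup>+x. epowr (ennreal \<bar>f i x\<bar>) (P i) * ennreal (\<sigma> i x) \<partial>lebesgue) (p / P i)))"
proof -
  have split: "ennreal \<bar>f i y * \<sigma> i y\<bar> = ennreal \<bar>f i y\<bar> * ennreal (\<sigma> i y)" for i y
    by (simp add: \<sigma>(1) dual_weight_def abs_mult ennreal_mult)
  have cong: "\<exists>Q\<in>cubes. emeasure lebesgue R = emeasure lebesgue Q
      \<and> (\<forall>g. (\<integral>\<^sup>+x\<in>R. g x \<partial>lebesgue) = (\<integral>\<^sup>+x\<in>Q. g x \<partial>lebesgue) \<and> mean lebesgue R g = mean lebesgue Q g)"
    if "R \<in> dyadic_grid t" for R :: "(real ^ 'n) set"
  proof -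
    obtain Q where Q: "Q \<in> cubes" "R \<in> sets lebesgue" "AE x in lebesgue. x \<in> R \<longleftrightarrow> x \<in> Q"
      using dyadic_grid_cube[OF \<open>R \<in> dyadic_grid t\<close>] by blast
    show ?thesis
      using mean_cong_AE_set[OF Q(3,2) cube_sets[OF Q(1)]] Q(1) by blast
  qed
  show ?thesis
    unfolding grid_maximal_def split
  proof (rule laminar_weighted_inequality)
    show "countable (dyadic_grid t)" by (rule countable_dyadic_grid)
    show "laminar (dyadic_grid t)" by (rule laminar_dyadic_grid)
    show "dyadic_grid t \<subseteq> sets lebesgue" using dyadic_grid_sets by blast
    show "(\<lambda>x. ennreal (v x)) \<in> borel_measurable lebesgue"
      using weight_measurable[OF v] by measurable
    show "1 / p = (\<Sum>i\<in>{1..m}. 1 / P i)" by (rule p(2))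
    show "{1..m} \<noteq> {}" using m by simp
  next
    fix R :: "(real ^ 'n) set" assume R: "R \<in> dyadic_grid t"
    show "emeasure lebesgue R \<noteq> 0" "emeasure lebesgue R \<noteq> top"
      using emeasure_dyadic_grid[OF R] by blast+
    obtain Q where Q: "Q \<in> cubes" "emeasure lebesgue R = emeasure lebesgue Q"
      "\<And>g. (\<integral>\<^sup>+x\<in>R. g x \<partial>lebesgue) = (\<integral>\<^sup>+x\<in>Q. g x \<partial>lebesgue)" "\<And>g. mean lebesgue R g = mean lebesgue Q g"
      using cong[OF R] by blast
    show "epowr (\<Prod>i\<in>{1..m}. mean lebesgue R (\<lambda>x. ennreal (\<sigma> i x))) p * (\<integral>\<^sup>+x\<in>R. ennreal (v x) \<partial>lebesgue)
      \<le> B_constant m P p v \<sigma> * (emeasure lebesgue R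
        * (\<Prod>i\<in>{1..m}. epowr (mean lebesgue R (\<lambda>x. epowr (ennreal (\<sigma> i x)) (1/2))) (2 * (p / P i))))"
      unfolding Q(2,3,4) by (rule B_constant_testing[OF P p(1) v w \<sigma> Q(1)])
    fix i assume i: "i \<in> {1..m}"
    show "(\<integral>\<^sup>+x\<in>R. ennreal (\<sigma> i x) \<partial>lebesgue) \<noteq> 0" "(\<integral>\<^sup>+x\<in>R. ennreal (\<sigma> i x) \<partial>lebesgue) \<noteq> top"
      unfolding Q(3)
      using mean_eq_average(3,4)[OF Q(1) weight_integrable_cube[OF \<sigma>(2)[OF i] Q(1)] weight_pos[OF \<sigma>(2)[OF i]]] by blast+
  next
    fix i assume i: "i \<in> {1..m}"
    show "1 < P i" by (rule P[OF i])
    show "(\<lambda>x. ennreal \<bar>f i x\<bar>) \<in> borel_measurable lebesgue" using f[OF i] by measurable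
    show "(\<lambda>x. ennreal (\<sigma> i x)) \<in> borel_measurable lebesgue"
      using weight_measurable[OF \<sigma>(2)[OF i]] by measurable
  qed auto
qed

theorem theorem3p5:
  fixes m :: nat and P :: "nat \<Rightarrow> real" and p :: real
  assumes "1 \<le> m"
    and "\<And>i. i \<in> {1..m} \<Longrightarrow> 1 < P i"
    and "1 / p = (\<Sum>i\<in>{1..m}. 1 / P i)"
  shows "\<exists>C::real. 0 < C \<and>
    (\<forall>(v :: real ^ 'n \<Rightarrow> real) (w :: nat \<Rightarrow> real ^ 'n \<Rightarrow> real) \<sigma> f.
       weight v \<longrightarrow>
       (\<forall>i\<in>{1..m}. weight (w i)) \<longrightarrow>
       \<sigma> = (\<lambda>i. dual_weight (P i) (w i)) \<longrightarrow>
       (\<forall>i\<in>{1..m}. weight (\<sigma> i)) \<longrightarrow>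
       (\<forall>i\<in>{1..m}. f i \<in> weighted_Lp (P i) (\<sigma> i)) \<longrightarrow>
       weighted_norm p v (multi_maximal m (\<lambda>i x. f i x * \<sigma> i x))
         \<le> ennreal C * epowr (B_constant m P p v \<sigma>) (1 / p)
             * (\<Prod>i\<in>{1..m}. weighted_norm (P i) (\<sigma> i) (\<lambda>x. ennreal \<bar>f i x\<bar>)))"
proof -
  have "0 < (\<Sum>i\<in>{1..m}. 1 / P i)"
    using assms(1,2) by (intro sum_pos) (auto intro: less_trans[OF zero_less_one])
  then have p: "0 < p" by (metis assms(3) zero_less_divide_1_iff)
  define C0 where "C0 = 2 ^ CARD('n) * ((6 ^ CARD('n)) ^ m) powr p * laminar_const {1..m} P p"
  have C0: "0 < C0"
    unfolding C0_def using assms(1,2) by (intro mult_pos_pos laminar_const_pos) auto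
  show ?thesis
  proof (intro exI[of _ "C0 powr (1 / p)"] conjI allI impI)
    show "0 < C0 powr (1 / p)" using C0 by simp
    fix v :: "real ^ 'n \<Rightarrow> real" and w :: "nat \<Rightarrow> real ^ 'n \<Rightarrow> real" and \<sigma> f
    assume v: "weight v" and w: "\<forall>i\<in>{1..m}. weight (w i)" and \<sigma>: "\<sigma> = (\<lambda>i. dual_weight (P i) (w i))"
      "\<forall>i\<in>{1..m}. weight (\<sigma> i)" and f: "\<forall>i\<in>{1..m}. f i \<in> weighted_Lp (P i) (\<sigma> i)"
    let ?B = "B_constant m P p v \<sigma>"
    let ?J = "\<lambda>i. \<integral>\<^sup>+x. epowr (ennreal \<bar>f i x\<bar>) (P i) * ennreal (\<sigma> i x) \<partial>lebesgue"
    have fm: "f i \<in> borel_measurable lebesgue" if "i \<in> {1..m}" for i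
      using f that by (auto simp: weighted_Lp_def)
    have "(\<integral>\<^sup>+x. epowr (multi_maximal m (\<lambda>i x. f i x * \<sigma> i x) x) p * ennreal (v x) \<partial>lebesgue)
      \<le> ennreal (2 ^ CARD('n) * ((6 ^ CARD('n)) ^ m) powr p)
        * (ennreal (laminar_const {1..m} P p) * (?B * (\<Prod>i\<in>{1..m}. epowr (?J i) (p / P i))))"
    proof (rule multi_maximal_le_of_grids[OF p])
      show "(\<lambda>x. ennreal (v x)) \<in> borel_measurable lebesgue"
        using weight_measurable[OF v] by measurable
      show "(\<integral>\<^sup>+x. epowr (grid_maximal {1..m} (\<lambda>i y. ennreal \<bar>f i y * \<sigma> i y\<bar>) t x) p * ennreal (v x) \<partial>lebesgue)
        \<le> ennreal (laminar_const {1..m} P p) * (?B * (\<Prod>i\<in>{1..m}. epowr (?J i) (p / P i)))" for t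
        using w \<sigma>(2) fm
        by (intro grid_maximal_weighted_inequality[OF assms(1,2) p assms(3) v _ \<sigma>(1)]) auto
    qed
    also have "\<dots> = ennreal C0 * (?B * (\<Prod>i\<in>{1..m}. epowr (?J i) (p / P i)))"
      unfolding C0_def using less_imp_le[OF laminar_const_pos[of "{1..m}" P p]] assms(1,2)
      by (subst ennreal_mult) (auto simp: mult.assoc)
    finally have "weighted_norm p v (multi_maximal m (\<lambda>i x. f i x * \<sigma> i x))
      \<le> epowr (ennreal C0 * (?B * (\<Prod>i\<in>{1..m}. epowr (?J i) (p / P i)))) (1 / p)"
      unfolding weighted_norm_def using p by (intro epowr_mono) auto
    also have "\<dots> = ennreal (C0 powr (1 / p)) * epowr ?B (1 / p) * (\<Prod>i\<in>{1..m}. weighted_norm (P i) (\<sigma> i) (\<lambda>x. ennreal \<bar>f i x\<bar>))"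
      using C0 p by (simp add: epowr_mult epowr_prod epowr_epowr epowr_ennreal weighted_norm_def mult.assoc)
    finally show "weighted_norm p v (multi_maximal m (\<lambda>i x. f i x * \<sigma> i x))
      \<le> ennreal (C0 powr (1 / p)) * epowr ?B (1 / p) * (\<Prod>i\<in>{1..m}. weighted_norm (P i) (\<sigma> i) (\<lambda>x. ennreal \<bar>f i x\<bar>))" .
  qed
qed

end
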